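(* Let $\{\Omega_t:-1<t<1\}$ be a uniformly bounded family of simply-connected domains in $\mathbb{C}$. Let $\delta_t$ denote the Euclidean boundary distance of $\Omega_t$. Suppose that $\Omega_t$ is $(-\delta_t)$-H\"older continuous of order $\alpha$ over $(-1,1)$. Then the Bergman kernel $K_t(z,w)$ of $\Omega_t$ is H\"older continuous of order $\alpha/2$ in $t$.
   Context: $\delta_t(z)$ is the Euclidean distance from $z\in\Omega_t$ to $\partial\Omega_t$. $K_t(z,w)$ is the reproducing kernel of the space of square integrable holomorphic functions on $\Omega_t$. Definition ($\rho_t$-H\"older continuity). Let $\rho$ be a negative continuous function on the total set $\{(z,t):z\in\Omega_t,\ t\in(-1,1)\}$ such that, with $\rho_t=\rho(\cdot,t)$, $\{-\rho_t>\varepsilon\}$ is relatively compact in $\Omega_t$ for all $\varepsilon>0$ and $t\in(-1,1)$. One says that $\Omega_t$ is $\rho_t$-H\"older continuous of order $\alpha$ over $(-1,1)$ if for each $\gamma>0$ there exist positive numbers $b_\gamma$ (large) and $c_\gamma$ (small) such that $\{-\rho_t>b_\gamma|t-s|^\alpha\}\subset\{-\rho_s>\gamma|t-s|^\alpha\}$ for all $t,s\in(-1,1)$ with $|t-s|\le c_\gamma$. Here it is applied with $\rho_t=-\delta_t$. "$K_t(z,w)$ is H\"older continuous of order $\beta$ in $t$" means: for every $t_0\in(-1,1)$ and $z,w\in\Omega_{t_0}$ there exist $C,\eta>0$ such that, for all $t,s$ with $|t-t_0|,|s-t_0|<\eta$, one has $z,w\in\Omega_t\cap\Omega_s$ and $|K_t(z,w)-K_s(z,w)|\le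 C|t-s|^\beta$. *)

theory Defs
  imports "HOL-Complex_Analysis.Complex_Analysis"
begin

definition bergman_space :: "complex set \<Rightarrow> (complex \<Rightarrow> complex) set" where
  "bergman_space \<Omega> =
     {f. f holomorphic_on \<Omega> \<and> set_integrable lborel \<Omega> (\<lambda>z. (cmod (f z))\<^sup>2)}"

definition is_reproducing_kernel ::
  "complex set \<Rightarrow> (complex \<Rightarrow> complex \<Rightarrow> complex) \<Rightarrow> bool" where
  "is_reproducing_kernel \<Omega> K \<longleftrightarrow>
     (\<forall>w\<in>\<Omega>. (\<lambda>z. K z w) \<in> bergman_space \<Omega> \<and>
        (\<forall>f\<in>bergman_space \<Omega>. f w = (LINT z:\<Omega>|lborel. f z * cnj (K z w))))"

text \<open>
  A reproducing kernel is determined on \<open>\<Omega> \<times> \<Omega>\<close> (lemma below), so the choice operator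
  only affects the values off \<open>\<Omega> \<times> \<Omega>\<close>.
\<close>

definition bergman_kernel :: "complex set \<Rightarrow> complex \<Rightarrow> complex \<Rightarrow> complex" where
  "bergman_kernel \<Omega> = (SOME K. is_reproducing_kernel \<Omega> K)"

lemma is_reproducing_kernel_unique:
  assumes K: "is_reproducing_kernel \<Omega> K" and L: "is_reproducing_kernel \<Omega> L"
    and z: "z \<in> \<Omega>" and w: "w \<in> \<Omega>"
  shows "K z w = L z w"
proof -
  have repr: "K' v u = cnj (L' u v)"
    if K': "is_reproducing_kernel \<Omega> K'" and L': "is_reproducing_kernel \<Omega> L'"
      and u: "u \<in> \<Omega>" and v: "v \<in> \<Omega>" for K' L' u v
  proof -
    have mem: "(\<lambda>x. K' x u) \<in> bergman_space \<Omega>" "(\<lambda>x. L' x v) \<in> bergman_space \<Omega>"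
      using K' L' u v by (auto simp: is_reproducing_kernel_def)
    have evK: "f u = (LINT x:\<Omega>|lborel. f x * cnj (K' x u))" if "f \<in> bergman_space \<Omega>" for f
      using K' u that by (simp add: is_reproducing_kernel_def)
    have evL: "f v = (LINT x:\<Omega>|lborel. f x * cnj (L' x v))" if "f \<in> bergman_space \<Omega>" for f
      using L' v that by (simp add: is_reproducing_kernel_def)
    have "K' v u = (LINT x:\<Omega>|lborel. K' x u * cnj (L' x v))"
      by (rule evL[OF mem(1)])
    also have "\<dots> = cnj (LINT x:\<Omega>|lborel. L' x v * cnj (K' x u))"
      unfolding set_lebesgue_integral_def
      by (subst Bochner_Integration.integral_cnj[symmetric]) (simp add: mult.commute)
    also have "(LINT x:\<Omega>|lborel. L' x v * cnj (K' x u)) = L' u v"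
      by (rule evK[OF mem(2), symmetric])
    finally show ?thesis .
  qed
  show ?thesis
    using repr[OF K K w z] repr[OF L K w z] by simp
qed

definition boundary_dist :: "complex set \<Rightarrow> complex \<Rightarrow> real" where
  "boundary_dist \<Omega> z = infdist z (frontier \<Omega>)"

text \<open>
  Families are functions of a real parameter of which only the values on \<open>(-1,1)\<close> matter;
  \<open>\<rho> t\<close> is likewise only looked at on \<open>\<Omega> t\<close>.
\<close>

definition admissible_weight :: "(real \<Rightarrow> complex set) \<Rightarrow> (real \<Rightarrow> complex \<Rightarrow> real) \<Rightarrow> bool" where
  "admissible_weight \<Omega> \<rho> \<longleftrightarrow>
     continuous_on {(z, t). t \<in> {-1<..<1} \<and> z \<in> \<Omega> t} (\<lambda>(z, t). \<rho> t z) \<and>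
     (\<forall>t\<in>{-1<..<1}. \<forall>z\<in>\<Omega> t. \<rho> t z < 0) \<and>
     (\<forall>t\<in>{-1<..<1}. \<forall>\<epsilon>>0.
        compact (closure {z \<in> \<Omega> t. - \<rho> t z > \<epsilon>}) \<and>
        closure {z \<in> \<Omega> t. - \<rho> t z > \<epsilon>} \<subseteq> \<Omega> t)"

definition hoelder_continuous_family ::
  "(real \<Rightarrow> complex set) \<Rightarrow> (real \<Rightarrow> complex \<Rightarrow> real) \<Rightarrow> real \<Rightarrow> bool" where
  "hoelder_continuous_family \<Omega> \<rho> \<alpha> \<longleftrightarrow>
     admissible_weight \<Omega> \<rho> \<and>
     (\<forall>\<gamma>>0. \<exists>b>0. \<exists>c>0. \<forall>t\<in>{-1<..<1}. \<forall>s\<in>{-1<..<1}. \<bar>t - s\<bar> \<le> c \<longrightarrow>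
        {z \<in> \<Omega> t. - \<rho> t z > b * \<bar>t - s\<bar> powr \<alpha>}
          \<subseteq> {z \<in> \<Omega> s. - \<rho> s z > \<gamma> * \<bar>t - s\<bar> powr \<alpha>})"

definition hoelder_continuous_kernel ::
  "(real \<Rightarrow> complex set) \<Rightarrow> (real \<Rightarrow> complex \<Rightarrow> complex \<Rightarrow> complex) \<Rightarrow> real \<Rightarrow> bool" where
  "hoelder_continuous_kernel \<Omega> K \<beta> \<longleftrightarrow>
     (\<forall>t\<^sub>0\<in>{-1<..<1}. \<forall>z\<in>\<Omega> t\<^sub>0. \<forall>w\<in>\<Omega> t\<^sub>0. \<exists>C>0. \<exists>\<eta>>0.
        \<forall>t\<in>{-1<..<1}. \<forall>s\<in>{-1<..<1}. \<bar>t - t\<^sub>0\<bar> < \<eta> \<and> \<bar>s - t\<^sub>0\<bar> < \<eta> \<longrightarrow>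
          z \<in> \<Omega> t \<inter> \<Omega> s \<and> w \<in> \<Omega> t \<inter> \<Omega> s \<and>
          cmod (K t z w - K s z w) \<le> C * \<bar>t - s\<bar> powr \<beta>)"

end

theory Submission
  imports Defs
begin

text \<open>
  Let \<open>\<phi>\<^sub>t\<close> be the Riemann map of \<open>\<Omega>\<^sub>t\<close> centred at \<open>z\<close>. By the Koebe-type estimate
  \<open>\<delta>\<^sub>t \<ge> c (1 - |\<phi>\<^sub>t|)\<^sup>2\<close>, the hypothesis puts the sublevel set \<open>D = {|\<phi>\<^sub>t| < 1 - \<kappa> |t - s|\<^bsup>\<alpha>/2\<^esup>}\<close>
  into \<open>\<Omega>\<^sub>t \<inter> \<Omega>\<^sub>s\<close>; this square is where the exponent \<open>\<alpha>/2\<close> comes from. On the diagonal the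
  explicit formula for the kernel of \<open>D\<close> gives \<open>K\<^sub>t \<le> K\<^sub>D \<le> K\<^sub>t + O(|t - s|\<^bsup>\<alpha>/2\<^esup>)\<close>, and exchanging
  \<open>t\<close> and \<open>s\<close> gives the same comparison with \<open>K\<^sub>s\<close>. Since \<open>K\<^sub>D - K\<^sub>t\<close> and \<open>K\<^sub>D - K\<^sub>s\<close> are positive
  semidefinite on \<open>D\<close>, the diagonal estimates control the off-diagonal values without loss.

  The Koebe-type estimate is applied to a branch \<open>g\<close> of \<open>(\<phi>\<^sub>t\<^sup>-\<^sup>1 - p)\<^bsup>1/2\<^esup>\<close> with \<open>p\<close> a boundary point:
  \<open>g\<close> is injective and \<open>g(\<zeta>) + g(\<omega>)\<close> never vanishes, hence \<open>|g'|(1 - |\<zeta>|\<^sup>2) \<le> 2|g|\<close> by the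
  Bieberbach--Eilenberg inequality, and integrating along radii gives \<open>|g| \<ge> c (1 - |\<zeta>|)\<close>.
\<close>

section \<open>Change of variables for injective holomorphic maps\<close>

text \<open>Coordinates are needed because the change-of-variables theorem used below is stated for
  maps of \<open>real^'n\<close> with a Jacobian determinant.\<close>

definition vec_of_complex :: "complex \<Rightarrow> real^2" where
  "vec_of_complex z = (\<chi> i. if i = 1 then Re z else Im z)"

definition complex_of_vec :: "real^2 \<Rightarrow> complex" where
  "complex_of_vec x = Complex (x $ 1) (x $ 2)"

lemma vec_of_complex_nth [simp]:
  "vec_of_complex z $ 1 = Re z" "vec_of_complex z $ 2 = Im z"
  by (auto simp: vec_of_complex_def)

lemma complex_of_vec_of_complex [simp]: "complex_of_vec (vec_of_complex z) = z"
  by (simp add: complex_of_vec_def)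

lemma vec_of_complex_of_vec [simp]: "vec_of_complex (complex_of_vec x) = x"
  by (simp add: complex_of_vec_def vec_eq_iff forall_2)

lemma linear_vec_of_complex: "linear vec_of_complex"
  by (rule linearI) (simp_all add: vec_eq_iff forall_2)

lemma linear_complex_of_vec: "linear complex_of_vec"
  by (rule linearI) (simp_all add: complex_of_vec_def complex_eq_iff)

lemma vec_of_complex_of_real_mult: "r *\<^sub>R vec_of_complex z = vec_of_complex (of_real r * z)"
  by (simp add: vec_eq_iff forall_2)

lemmas bounded_linear_vec_of_complex = linear_conv_bounded_linear[THEN iffD1, OF linear_vec_of_complex]
lemmas bounded_linear_complex_of_vec = linear_conv_bounded_linear[THEN iffD1, OF linear_complex_of_vec]

lemma vec_of_complex_measurable [measurable]: "vec_of_complex \<in> borel_measurable borel"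
  by (intro borel_measurable_continuous_onI linear_continuous_on bounded_linear_vec_of_complex)

lemma complex_of_vec_measurable [measurable]: "complex_of_vec \<in> borel_measurable borel"
  by (intro borel_measurable_continuous_onI linear_continuous_on bounded_linear_complex_of_vec)

lemma Basis_real2: "(Basis :: (real^2) set) = {axis 1 1, axis 2 1}"
  by (auto simp: Basis_vec_def UNIV_2)

lemma axis_12_neq: "axis 1 1 \<noteq> (axis 2 1 :: real^2)"
  by (simp add: axis_eq_axis)

text \<open>Lebesgue measure is determined by its values on boxes, and the coordinate map matches
  boxes with boxes of the same side lengths.\<close>

lemma lborel_vec_of_complex: "(lborel :: (real^2) measure) = distr lborel borel vec_of_complex"
proof (rule lborel_eqI)
  fix l u :: "real^2"
  assume le: "\<And>b. b \<in> Basis \<Longrightarrow> l \<bullet> b \<le> u \<bullet> b"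
  have le': "l $ 1 \<le> u $ 1" "l $ 2 \<le> u $ 2"
    using le[of "axis 1 1"] le[of "axis 2 1"] by (auto simp: Basis_real2 inner_axis)
  have "vec_of_complex -` box l u = box (complex_of_vec l) (complex_of_vec u)"
    by (auto simp: mem_box Basis_real2 inner_axis Basis_complex_def complex_of_vec_def)
  then have "emeasure (distr lborel borel vec_of_complex) (box l u) =
      emeasure lborel (box (complex_of_vec l) (complex_of_vec u))"
    by (simp add: emeasure_distr)
  also have "\<dots> = (\<Prod>b\<in>Basis. (complex_of_vec u - complex_of_vec l) \<bullet> b)"
    using le' by (intro emeasure_lborel_box) (auto simp: Basis_complex_def complex_of_vec_def)
  also have "(\<Prod>b\<in>Basis. (complex_of_vec u - complex_of_vec l) \<bullet> b) = (\<Prod>b\<in>Basis. (u - l) \<bullet> b)"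
    using axis_12_neq by (simp add: Basis_complex_def complex_of_vec_def Basis_real2 inner_axis algebra_simps)
  finally show "emeasure (distr lborel borel vec_of_complex) (box l u) = (\<Prod>b\<in>Basis. (u - l) \<bullet> b)" .
qed simp

text \<open>For \<open>c = a + ib\<close> the matrix has rows (a, -b) and (b, a). This is the real
  Jacobian of a holomorphic map with derivative \<open>c\<close>.\<close>

lemma det_matrix_complex_mult:
  "det (matrix (\<lambda>x. vec_of_complex (c * complex_of_vec x))) = (cmod c)\<^sup>2"
  by (simp add: det_2 matrix_def complex_of_vec_def cmod_power2 axis_def flip: power2_eq_square)

text \<open>The left side refers to completed Lebesgue measure, the right side to
  \<open>lborel\<close>. Continuity on an open set makes the function extended by 0 Borel
  measurable, so completion changes nothing.\<close>

lemma set_integrable_vec_iff: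
  fixes h :: "complex \<Rightarrow> complex"
  assumes S: "open S" and h: "continuous_on S h"
  defines "f \<equiv> vec_of_complex \<circ> h \<circ> complex_of_vec"
  shows "f absolutely_integrable_on (vec_of_complex ` S) \<longleftrightarrow> set_integrable lborel S h"
    and "set_integrable lborel S h \<Longrightarrow>
      integral (vec_of_complex ` S) f = vec_of_complex (LINT z:S|lborel. h z)"
proof -
  let ?H = "\<lambda>z. indicator S z *\<^sub>R h z"
  have H[measurable]: "?H \<in> borel_measurable borel"
    using borel_measurable_continuous_on_indicator[OF _ h] S by auto
  have eq: "indicator (vec_of_complex ` S) x *\<^sub>R f x = vec_of_complex (?H (complex_of_vec x))" for x
  proof -
    have "x \<in> vec_of_complex ` S \<longleftrightarrow> complex_of_vec x \<in> S"
      by (metis complex_of_vec_of_complex image_iff vec_of_complex_of_vec)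
    then show ?thesis
      by (auto simp: indicator_def f_def linear_0[OF linear_vec_of_complex])
  qed
  have m: "(\<lambda>x. vec_of_complex (?H (complex_of_vec x))) \<in> borel_measurable lborel"
    by measurable
  have iff: "integrable lborel (\<lambda>z. vec_of_complex (?H z)) \<longleftrightarrow> integrable lborel ?H"
  proof
    assume "integrable lborel (\<lambda>z. vec_of_complex (?H z))"
    from integrable_bounded_linear[OF bounded_linear_complex_of_vec this]
    show "integrable lborel ?H" by simp
  qed (rule integrable_bounded_linear[OF bounded_linear_vec_of_complex])
  have e: "f absolutely_integrable_on (vec_of_complex ` S)
      \<longleftrightarrow> integrable lborel (\<lambda>x. vec_of_complex (?H (complex_of_vec x)))"
    unfolding set_integrable_def eq using integrable_completion[OF m] by simp
  also have "\<dots> \<longleftrightarrow> integrable lborel (\<lambda>z. vec_of_complex (?H z))"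
    by (subst lborel_vec_of_complex, subst integrable_distr_eq) auto
  finally show iff2: "f absolutely_integrable_on (vec_of_complex ` S) \<longleftrightarrow> set_integrable lborel S h"
    using iff unfolding set_integrable_def by simp
  assume h': "set_integrable lborel S h"
  have "integral (vec_of_complex ` S) f = (LINT x:vec_of_complex ` S|lebesgue. f x)"
    using set_lebesgue_integral_eq_integral(2)[of "vec_of_complex ` S" f] h' iff2 by simp
  also have "\<dots> = (LINT x|lborel. vec_of_complex (?H (complex_of_vec x)))"
    unfolding set_lebesgue_integral_def eq by (rule integral_completion[OF m])
  also have "\<dots> = (LINT z|lborel. vec_of_complex (?H z))"
    by (subst lborel_vec_of_complex, subst integral_distr) auto
  also have "\<dots> = vec_of_complex (LINT z|lborel. ?H z)"
    using h' by (intro integral_bounded_linear bounded_linear_vec_of_complex) (simp add: set_integrable_def)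
  finally show "integral (vec_of_complex ` S) f = vec_of_complex (LINT z:S|lborel. h z)"
    by (simp add: set_lebesgue_integral_def)
qed

text \<open>By the Cauchy-Riemann equations the real Jacobian determinant is the squared modulus of
  the complex derivative.\<close>

lemma holomorphic_change_of_variables:
  fixes h :: "complex \<Rightarrow> complex"
  assumes S: "open S" and hol: "\<phi> holomorphic_on S" and inj: "inj_on \<phi> S"
    and h: "continuous_on (\<phi> ` S) h"
  shows "set_integrable lborel (\<phi> ` S) h \<longleftrightarrow>
           set_integrable lborel S (\<lambda>z. of_real ((cmod (deriv \<phi> z))\<^sup>2) * h (\<phi> z))" (is ?A)
    and "(LINT w:\<phi> ` S|lborel. h w) =
           (LINT z:S|lborel. of_real ((cmod (deriv \<phi> z))\<^sup>2) * h (\<phi> z))" (is ?B)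
proof -
  let ?k = "\<lambda>z. of_real ((cmod (deriv \<phi> z))\<^sup>2) * h (\<phi> z)"
  define g where "g = vec_of_complex \<circ> \<phi> \<circ> complex_of_vec"
  define g' where "g' = (\<lambda>x y. vec_of_complex (deriv \<phi> (complex_of_vec x) * complex_of_vec y))"
  define f where "f = vec_of_complex \<circ> h \<circ> complex_of_vec"
  let ?S = "vec_of_complex ` S"
  have opS: "open (\<phi> ` S)"
    using open_mapping_thm3[OF hol S inj] .
  have cont\<phi>: "continuous_on S \<phi>" "continuous_on S (deriv \<phi>)"
    using hol S by (auto intro: holomorphic_on_imp_continuous_on holomorphic_deriv)
  have contk: "continuous_on S ?k"
    by (intro continuous_intros cont\<phi> continuous_on_compose2[OF h cont\<phi>(1)]) auto
  have eqS: "?S = complex_of_vec -` S"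
    by (metis (mono_tags, opaque_lifting) complex_of_vec_of_complex image_iff subsetI subset_antisym vec_of_complex_of_vec vimage_eq)
  have "open ?S"
    unfolding eqS by (intro open_vimage S linear_continuous_on bounded_linear_complex_of_vec)
  then have meas: "?S \<in> sets lebesgue"
    by auto
  have der: "(g has_derivative g' x) (at x within ?S)" if "x \<in> ?S" for x
  proof -
    have "complex_of_vec x \<in> S" using that by auto
    then have 1: "(\<phi> has_derivative (*) (deriv \<phi> (complex_of_vec x))) (at (complex_of_vec x))"
      using holomorphic_derivI[OF hol S, of "complex_of_vec x"] by (simp add: has_field_derivative_def)
    have 2: "((\<lambda>y. \<phi> (complex_of_vec y)) has_derivative
        (\<lambda>y. deriv \<phi> (complex_of_vec x) * complex_of_vec y)) (at x)"
      by (rule has_derivative_compose[OF bounded_linear_imp_has_derivative[OF bounded_linear_complex_of_vec] 1])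
    show ?thesis
      unfolding g_def g'_def o_def
      by (rule has_derivative_at_withinI,
          rule has_derivative_compose[OF 2 bounded_linear_imp_has_derivative[OF bounded_linear_vec_of_complex]])
  qed
  have injg: "inj_on g ?S"
    using inj by (auto simp: g_def inj_on_def) (metis complex_of_vec_of_complex)
  have gS: "g ` ?S = vec_of_complex ` (\<phi> ` S)"
    by (simp add: g_def image_image)
  have integrand: "(\<lambda>x. \<bar>det (matrix (g' x))\<bar> *\<^sub>R f (g x)) = vec_of_complex \<circ> ?k \<circ> complex_of_vec"
    by (simp add: fun_eq_iff g'_def det_matrix_complex_mult f_def g_def vec_of_complex_of_real_mult del: of_real_power)
  \<comment> \<open>The value \<open>b\<close> is arbitrary: instantiating it with either integral
    gives integrability in both directions, and equality of the integrals.\<close>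
  have cv: "(vec_of_complex \<circ> ?k \<circ> complex_of_vec) absolutely_integrable_on ?S \<and>
        integral ?S (vec_of_complex \<circ> ?k \<circ> complex_of_vec) = b \<longleftrightarrow>
      (vec_of_complex \<circ> h \<circ> complex_of_vec) absolutely_integrable_on (vec_of_complex ` (\<phi> ` S)) \<and>
        integral (vec_of_complex ` (\<phi> ` S)) (vec_of_complex \<circ> h \<circ> complex_of_vec) = b" for b
    using has_absolute_integral_change_of_variables[OF meas der injg, of f b]
    unfolding integrand gS unfolding f_def by simp
  note R = set_integrable_vec_iff[OF opS h]
  note L = set_integrable_vec_iff[OF S contk]
  show ?A
    using cv R(1) L(1) by blast
  show ?B
  proof (cases "set_integrable lborel S ?k")
    case True
    then have T: "set_integrable lborel (\<phi> ` S) h" using \<open>?A\<close> by simp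
    have "vec_of_complex (LINT w:\<phi> ` S|lborel. h w) = vec_of_complex (LINT z:S|lborel. ?k z)"
      using cv R L True T by metis
    then show ?thesis by (metis complex_of_vec_of_complex)
  next
    \<comment> \<open>Neither side is integrable here, so both integrals have the default value
      0.\<close>
    case False
    then show ?thesis
      using \<open>?A\<close> by (simp add: set_integrable_def set_lebesgue_integral_def not_integrable_integral_eq)
  qed
qed

section \<open>Mean values over rotation-invariant sets\<close>

text \<open>Rotation by \<open>c\<close> with \<open>c ^ n = -1\<close> preserves the set and the
  weight but changes the sign of the integrand, so the integral equals its own negative.\<close>

lemma set_integral_rotation_power:
  fixes \<omega> :: "complex \<Rightarrow> complex"
  assumes S: "open S" and rot: "\<And>c z. cmod c = 1 \<Longrightarrow> z \<in> S \<Longrightarrow> c * z \<in> S"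
    and cont: "continuous_on S \<omega>" and \<omega>: "\<And>c z. cmod c = 1 \<Longrightarrow> z \<in> S \<Longrightarrow> \<omega> (c * z) = \<omega> z"
    and n: "n > 0"
  shows "(LINT z:S|lborel. \<omega> z * z ^ n) = 0"
proof -
  define c where "c = cis (pi / n)"
  have c: "cmod c = 1" by (simp add: c_def)
  have cn: "c ^ n = -1"
  proof -
    have "c ^ n = cis (real n * (pi / n))"
      unfolding c_def by (rule Complex.DeMoivre)
    then show ?thesis using n by simp
  qed
  have c0: "c \<noteq> 0" using c by auto
  have im: "(*) c ` S = S"
  proof
    show "S \<subseteq> (*) c ` S"
    proof
      fix z assume "z \<in> S"
      then have "inverse c * z \<in> S" using c by (intro rot) (auto simp: norm_inverse)
      then show "z \<in> (*) c ` S" using c0 by (intro image_eqI[of _ _ "inverse c * z"]) auto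
    qed
  qed (use c rot in auto)
  have "(LINT z:(*) c ` S|lborel. \<omega> z * z ^ n) =
      (LINT z:S|lborel. of_real ((cmod (deriv ((*) c) z))\<^sup>2) * (\<omega> (c * z) * (c * z) ^ n))"
    using c0 by (intro holomorphic_change_of_variables(2) S holomorphic_intros)
      (auto simp: im inj_on_def intro!: continuous_intros cont)
  also have "\<dots> = (LINT z:S|lborel. - (\<omega> z * z ^ n))"
    using S by (intro set_lebesgue_integral_cong) (auto simp: c \<omega> power_mult_distrib cn)
  also have "\<dots> = - (LINT z:S|lborel. \<omega> z * z ^ n)"
    by (simp add: set_lebesgue_integral_def)
  finally show ?thesis
    unfolding im by simp
qed

text \<open>The Taylor series of \<open>F\<close> at 0 is integrated term by term; all powers except
  the constant one integrate to 0.\<close>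

lemma set_integral_rotation_holomorphic:
  fixes \<omega> :: "complex \<Rightarrow> complex"
  assumes S: "open S" and rot: "\<And>c z. cmod c = 1 \<Longrightarrow> z \<in> S \<Longrightarrow> c * z \<in> S"
    and cont: "continuous_on S \<omega>" and \<omega>: "\<And>c z. cmod c = 1 \<Longrightarrow> z \<in> S \<Longrightarrow> \<omega> (c * z) = \<omega> z"
    and int: "set_integrable lborel S \<omega>"
    and sub: "S \<subseteq> cball 0 \<rho>" "0 < \<rho>" "\<rho> < R" and F: "F holomorphic_on ball 0 R"
  shows "set_integrable lborel S (\<lambda>z. \<omega> z * F z)"
    and "(LINT z:S|lborel. \<omega> z * F z) = F 0 * (LINT z:S|lborel. \<omega> z)"
proof -
  define a where "a n = (deriv ^^ n) F 0 / fact n" for n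
  have sums: "(\<lambda>n. a n * z ^ n) sums F z" if "z \<in> ball 0 R" for z
    using holomorphic_power_series[OF F that] by (simp add: a_def)
  define f where "f n z = indicator S z *\<^sub>R (\<omega> z * (a n * z ^ n))" for n z
  have [measurable]: "S \<in> sets borel" using S by auto
  have bound: "norm (f n z) \<le> cmod (a n) * \<rho> ^ n * norm (indicator S z *\<^sub>R \<omega> z)" for n z
  proof (cases "z \<in> S")
    case True
    then have "cmod z ^ n \<le> \<rho> ^ n" using sub by (intro power_mono) auto
    then have "cmod (\<omega> z) * (cmod (a n) * cmod z ^ n) \<le> cmod (\<omega> z) * (cmod (a n) * \<rho> ^ n)"
      by (intro mult_left_mono) auto
    then show ?thesis using True by (simp add: f_def norm_mult norm_power mult_ac)
  qed (simp add: f_def)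
  have \<omega>int: "integrable lborel (\<lambda>z. indicator S z *\<^sub>R \<omega> z)"
    using int by (simp add: set_integrable_def)
  have fm: "f n \<in> borel_measurable lborel" for n
  proof -
    have "f n = (\<lambda>z. (indicator S z *\<^sub>R \<omega> z) * (a n * z ^ n))"
      by (auto simp: f_def)
    moreover have "(\<lambda>z. (indicator S z *\<^sub>R \<omega> z) * (a n * z ^ n)) \<in> borel_measurable lborel"
      using borel_measurable_integrable[OF \<omega>int] by measurable
    ultimately show ?thesis by simp
  qed
  have fint: "integrable lborel (f n)" for n
    by (rule Bochner_Integration.integrable_bound[OF integrable_mult_right[OF integrable_norm[OF \<omega>int], of "cmod (a n) * \<rho> ^ n"] fm])
       (use bound sub in \<open>auto simp: abs_mult\<close>)
  \<comment> \<open>Convergence at some radius strictly between \<rho> and \<open>R\<close> gives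
    absolute convergence at \<rho>, which dominates the series on all of \<open>S\<close>.\<close>
  have sa: "summable (\<lambda>n. cmod (a n) * \<rho> ^ n)"
  proof -
    obtain \<rho>' where \<rho>': "\<rho> < \<rho>'" "\<rho>' < R" using sub dense by blast
    then have "summable (\<lambda>n. a n * of_real \<rho>' ^ n)"
      using sums[of "of_real \<rho>'"] sub by (auto simp: sums_iff)
    from powser_insidea[OF this, of "of_real \<rho>"] show ?thesis
      using \<rho>' sub by (simp add: norm_mult norm_power)
  qed
  have s1: "AE z in lborel. summable (\<lambda>n. norm (f n z))"
    by (intro AE_I2 summable_comparison_test'[OF summable_mult2[OF sa]]) (use bound in auto)
  have s2: "summable (\<lambda>n. \<integral>z. norm (f n z) \<partial>lborel)"
  proof (rule summable_comparison_test'[OF summable_mult2[OF sa]])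
    fix n
    have "(\<integral>z. norm (f n z) \<partial>lborel) \<le> (\<integral>z. cmod (a n) * \<rho> ^ n * norm (indicator S z *\<^sub>R \<omega> z) \<partial>lborel)"
      by (intro integral_mono integrable_norm fint integrable_mult_right \<omega>int bound)
    then show "norm (\<integral>z. norm (f n z) \<partial>lborel) \<le> cmod (a n) * \<rho> ^ n * (\<integral>z. norm (indicator S z *\<^sub>R \<omega> z) \<partial>lborel)"
      by simp
  qed
  have eq: "(\<Sum>n. f n z) = indicator S z *\<^sub>R (\<omega> z * F z)" for z
  proof (cases "z \<in> S")
    case True
    then have "z \<in> ball 0 R" using sub by force
    then have "(\<lambda>n. \<omega> z * (a n * z ^ n)) sums (\<omega> z * F z)"
      by (intro sums_mult sums)
    then show ?thesis using True by (simp add: f_def sums_iff)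
  qed (simp add: f_def)
  show "set_integrable lborel S (\<lambda>z. \<omega> z * F z)"
    using integrable_suminf[OF fint s1 s2] unfolding eq set_integrable_def .
  have "integral\<^sup>L lborel (f n) = (if n = 0 then F 0 * (LINT z:S|lborel. \<omega> z) else 0)" for n
  proof -
    have "integral\<^sup>L lborel (f n) = a n * (LINT z:S|lborel. \<omega> z * z ^ n)"
      unfolding set_lebesgue_integral_def
      by (subst integral_mult_right_zero[symmetric]) (simp add: f_def[abs_def] mult_ac)
    moreover have "a 0 = F 0" by (simp add: a_def)
    ultimately show ?thesis
      using set_integral_rotation_power[OF S rot cont \<omega>, of n] by auto
  qed
  then have "(\<lambda>n. integral\<^sup>L lborel (f n)) sums (F 0 * (LINT z:S|lborel. \<omega> z))"
    using sums_single[of 0 "\<lambda>n. F 0 * (LINT z:S|lborel. \<omega> z)"] by simp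
  moreover have "(\<lambda>n. integral\<^sup>L lborel (f n)) sums (LINT z:S|lborel. \<omega> z * F z)"
    using sums_integral[OF fint s1 s2] unfolding eq set_lebesgue_integral_def .
  ultimately show "(LINT z:S|lborel. \<omega> z * F z) = F 0 * (LINT z:S|lborel. \<omega> z)"
    using sums_unique2 by blast
qed

lemma set_integrable_const_bounded:
  fixes c :: "'b::{banach, second_countable_topology}" and E :: "'a::euclidean_space set"
  assumes "E \<in> sets borel" "bounded E"
  shows "set_integrable lborel E (\<lambda>_. c)"
  unfolding set_integrable_def using assms
  by (intro integrable_scaleR_left integrable_real_indicator) (use emeasure_bounded_finite in auto)

text \<open>\<open>F\<close> is holomorphic only on the open disc, so the rotation argument is
  applied to concentric smaller discs, which exhaust it; integrability justifies the limit.\<close>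

lemma disc_mean_value:
  fixes F :: "complex \<Rightarrow> complex"
  assumes F: "F holomorphic_on ball 0 1" and int: "set_integrable lborel (ball 0 1) F"
  shows "(LINT z:ball 0 1|lborel. F z) = pi * F 0"
proof -
  \<comment> \<open>The double successor makes the first radius 1/2 instead of 0.\<close>
  define \<rho> where "\<rho> n = 1 - inverse (of_nat (Suc (Suc n)) :: real)" for n
  have \<rho>: "0 < \<rho> n" "\<rho> n < 1" for n
    by (auto simp: \<rho>_def field_simps)
  have lim: "\<rho> \<longlonglongrightarrow> 1"
    unfolding \<rho>_def using tendsto_diff[OF tendsto_const[of 1] LIMSEQ_Suc[OF LIMSEQ_inverse_real_of_nat]]
    by simp
  have inc: "incseq (\<lambda>n. ball 0 (\<rho> n) :: complex set)"
    by (auto simp: incseq_def \<rho>_def intro!: subset_ball elim!: less_le_trans)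
  have Un: "(\<Union>n. ball 0 (\<rho> n)) = (ball 0 1 :: complex set)"
  proof
    show "ball 0 1 \<subseteq> (\<Union>n. ball 0 (\<rho> n) :: complex set)"
    proof
      fix z :: complex assume "z \<in> ball 0 1"
      then have "eventually (\<lambda>n. \<rho> n > cmod z) sequentially"
        using order_tendstoD(1)[OF lim, of "cmod z"] by auto
      then show "z \<in> (\<Union>n. ball 0 (\<rho> n))" 
        using eventually_happens'[OF sequentially_bot] by fastforce
    qed
  qed (auto dest: less_trans[OF _ \<rho>(2)])
  have "(\<lambda>n. LINT z:ball 0 (\<rho> n)|lborel. F z) \<longlonglongrightarrow> (LINT z:(\<Union>n. ball 0 (\<rho> n))|lborel. F z)"
    using inc int by (intro set_integral_cont_up) (auto simp: Un)
  moreover have "(LINT z:ball 0 (\<rho> n)|lborel. F z) = of_real (pi * \<rho> n ^ 2) * F 0" for n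
  proof -
    have "set_integrable lborel (ball 0 (\<rho> n)) (\<lambda>z :: complex. 1 :: complex)"
      by (intro set_integrable_const_bounded) auto
    from set_integral_rotation_holomorphic(2)[OF _ _ _ _ this ball_subset_cball \<rho> F]
    have "(LINT z:ball 0 (\<rho> n)|lborel. 1 * F z) = F 0 * (LINT z:(ball 0 (\<rho> n) :: complex set)|lborel. 1)"
      by (auto simp: norm_mult)
    moreover have "(LINT z:(ball 0 (\<rho> n) :: complex set)|lborel. 1 :: complex) = of_real (pi * \<rho> n ^ 2)"
      using \<rho>[of n] content_ball[of "\<rho> n" "0::complex"]
      by (simp add: set_lebesgue_integral_def unit_ball_vol_2 emeasure_bounded_finite scaleR_conv_of_real)
    ultimately show ?thesis by simp
  qed
  moreover have "(\<lambda>n. of_real (pi * \<rho> n ^ 2) * F 0) \<longlonglongrightarrow> of_real (pi * 1 ^ 2) * F 0"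
    by (intro tendsto_intros lim)
  ultimately show ?thesis
    using LIMSEQ_unique by (simp add: Un) blast
qed

section \<open>The Bieberbach--Eilenberg inequality\<close>

lemma set_integrable_of_real_iff:
  fixes f :: "'a \<Rightarrow> real"
  shows "set_integrable M E (\<lambda>w. complex_of_real (f w)) \<longleftrightarrow> set_integrable M E f"
proof -
  have "indicator E w *\<^sub>R complex_of_real (f w) = complex_of_real (indicator E w *\<^sub>R f w)" for w
    by (simp add: scaleR_conv_of_real)
  then show ?thesis
    unfolding set_integrable_def by (simp only: complex_of_real_integrable_eq)
qed

lemma set_integral_Re:
  assumes "set_integrable M A f"
  shows "set_integrable M A (\<lambda>x. Re (f x))" "(LINT x:A|M. Re (f x)) = Re (LINT x:A|M. f x)"
proof -
  have eq: "Re (indicator A x *\<^sub>R f x) = indicator A x *\<^sub>R Re (f x)" for x by simp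
  show "set_integrable M A (\<lambda>x. Re (f x))"
    using integrable_Re[OF assms[unfolded set_integrable_def]] unfolding eq set_integrable_def .
  show "(LINT x:A|M. Re (f x)) = Re (LINT x:A|M. f x)"
    using integral_Re[OF assms[unfolded set_integrable_def]] unfolding eq set_lebesgue_integral_def by simp
qed

lemma holomorphic_change_of_variables_real:
  fixes h :: "complex \<Rightarrow> real"
  assumes S: "open S" and hol: "\<phi> holomorphic_on S" and inj: "inj_on \<phi> S"
    and h: "continuous_on (\<phi> ` S) h"
  shows "set_integrable lborel (\<phi> ` S) h \<longleftrightarrow>
           set_integrable lborel S (\<lambda>z. (cmod (deriv \<phi> z))\<^sup>2 * h (\<phi> z))"
    and "(LINT w:\<phi> ` S|lborel. h w) = (LINT z:S|lborel. (cmod (deriv \<phi> z))\<^sup>2 * h (\<phi> z))"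
proof -
  have c: "continuous_on (\<phi> ` S) (\<lambda>w. complex_of_real (h w))"
    by (intro continuous_intros h)
  note iff = set_integrable_of_real_iff
  note cv = holomorphic_change_of_variables[OF S hol inj c]
  show "set_integrable lborel (\<phi> ` S) h \<longleftrightarrow>
      set_integrable lborel S (\<lambda>z. (cmod (deriv \<phi> z))\<^sup>2 * h (\<phi> z))"
    using cv(1) unfolding of_real_mult[symmetric] iff .
  show "(LINT w:\<phi> ` S|lborel. h w) = (LINT z:S|lborel. (cmod (deriv \<phi> z))\<^sup>2 * h (\<phi> z))"
    using cv(2) unfolding of_real_mult[symmetric] set_integral_complex_of_real of_real_eq_iff .
qed

section \<open>The inversion-invariant measure dA/|w|^2 on annuli\<close>

lemma set_integrable_inverse_square:
  assumes E: "E \<in> sets borel" and sub: "\<And>w. w \<in> E \<Longrightarrow> a \<le> cmod w \<and> cmod w \<le> b" and a: "0 < a"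
  shows "set_integrable lborel E (\<lambda>w. 1 / (cmod w)\<^sup>2)"
proof (rule set_integrable_bound)
  have "bounded E"
    using sub by (auto intro!: boundedI)
  then show "set_integrable lborel E (\<lambda>w. 1 / a\<^sup>2)"
    using E by (intro set_integrable_const_bounded)
  show "set_borel_measurable lborel E (\<lambda>w. 1 / (cmod w)\<^sup>2)"
    using E unfolding set_borel_measurable_def by measurable
  show "AE x in lborel. x \<in> E \<longrightarrow> norm (1 / (cmod x)\<^sup>2) \<le> norm (1 / a\<^sup>2)"
  proof (intro AE_I2 impI)
    fix x assume "x \<in> E"
    then have "a\<^sup>2 \<le> (cmod x)\<^sup>2" using sub a by (intro power_mono) auto
    then show "norm (1 / (cmod x)\<^sup>2) \<le> norm (1 / a\<^sup>2)"
      using a by (auto intro!: divide_left_mono mult_pos_pos)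
  qed
qed

lemma AE_lborel_cmod_neq: "AE w in lborel. cmod w \<noteq> s"
proof -
  have "sphere (0::complex) s \<in> null_sets lebesgue"
    using negligible_sphere[of "0::complex" s] by (simp add: negligible_iff_null_sets)
  then have "sphere (0::complex) s \<in> null_sets lborel"
    by (simp add: null_sets_def emeasure_completion)
  then show ?thesis
    by (rule AE_I') auto
qed

text \<open>The measure dA/|w|^2 is invariant under inversion, which exchanges
  \<open>m < |w| < 1\<close> with \<open>1 < |w| < 1/m\<close>. The three circles of radius
  \<open>m\<close>, 1 and \<open>1/m\<close> are null sets.\<close>

lemma set_integral_inverse_square_annulus_le:
  assumes E: "E \<in> sets borel" and sub: "\<And>w. w \<in> E \<Longrightarrow> m \<le> cmod w \<and> cmod w \<le> 1 / m"
    and m: "0 < m" "m < 1"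
  shows "(LINT w:E|lborel. 1 / (cmod w)\<^sup>2) \<le> 2 * (LINT w:{w. m < cmod w \<and> cmod w < 1}|lborel. 1 / (cmod w)\<^sup>2)"
proof -
  define h where "h w = 1 / (cmod w)\<^sup>2" for w :: complex
  let ?O1 = "{w :: complex. m < cmod w \<and> cmod w < 1}"
  let ?O2 = "{w :: complex. 1 < cmod w \<and> cmod w < 1 / m}"
  have op: "open ?O1" "open ?O2"
    by (intro open_Collect_conj open_Collect_less continuous_intros)+
  have hint: "set_integrable lborel E h" "set_integrable lborel ?O1 h" "set_integrable lborel ?O2 h"
    unfolding h_def using set_integrable_inverse_square[OF E, of m "1/m"] sub m
      set_integrable_inverse_square[of ?O1 m 1] set_integrable_inverse_square[of ?O2 1 "1/m"] op
    by auto
  have im: "inverse ` ?O1 = ?O2"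
  proof
    show "inverse ` ?O1 \<subseteq> ?O2"
    proof
      fix w :: complex assume "w \<in> inverse ` ?O1"
      then obtain z where z: "m < cmod z" "cmod z < 1" "w = inverse z" by auto
      then have "0 < cmod z" using m by linarith
      then have "1 < inverse (cmod z)" "inverse (cmod z) < 1 / m"
        using m z by (simp_all add: divide_simps del: zero_less_norm_iff)
      then show "w \<in> ?O2" using z by (simp only: norm_inverse mem_Collect_eq)
    qed
    show "?O2 \<subseteq> inverse ` ?O1"
    proof
      fix w :: complex assume w: "w \<in> ?O2"
      then have "0 < cmod w" by (auto intro: less_trans[of 0 1])
      then have "m < inverse (cmod w)" "inverse (cmod w) < 1"
        using w m by (auto simp: field_simps)
      then have "inverse w \<in> ?O1"
        by (simp only: norm_inverse mem_Collect_eq)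
      then show "w \<in> inverse ` ?O1"
        by (intro image_eqI[of _ _ "inverse w"]) auto
    qed
  qed
  have nz: "w \<noteq> 0" if "w \<in> ?O1" for w using that m by auto
  have "(LINT w:inverse ` ?O1|lborel. h w) = (LINT z:?O1|lborel. (cmod (deriv inverse z))\<^sup>2 * h (inverse z))"
    using op nz by (intro holomorphic_change_of_variables_real(2) holomorphic_intros)
      (auto simp: inj_on_def h_def intro!: continuous_intros)
  also have "\<dots> = (LINT z:?O1|lborel. h z)"
  proof (intro set_lebesgue_integral_cong allI impI)
    fix z assume "z \<in> ?O1"
    then have "z \<noteq> 0" using nz by blast
    then show "(cmod (deriv inverse z))\<^sup>2 * h (inverse z) = h z"
      by (simp add: h_def norm_inverse norm_divide norm_power norm_mult field_simps power2_eq_square)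
  qed (use op in auto)
  finally have O2: "(LINT w:?O2|lborel. h w) = (LINT z:?O1|lborel. h z)"
    unfolding im .
  have "(LINT w:E|lborel. h w) \<le> (LINT w|lborel. indicator ?O1 w *\<^sub>R h w + indicator ?O2 w *\<^sub>R h w)"
    unfolding set_lebesgue_integral_def
  proof (rule integral_mono_AE)
    show "integrable lborel (\<lambda>w. indicator ?O1 w *\<^sub>R h w + indicator ?O2 w *\<^sub>R h w)"
      using hint unfolding set_integrable_def by (intro Bochner_Integration.integrable_add)
    show "AE w in lborel. indicator E w *\<^sub>R h w \<le> indicator ?O1 w *\<^sub>R h w + indicator ?O2 w *\<^sub>R h w"
      using AE_lborel_cmod_neq[of 1] AE_lborel_cmod_neq[of m] AE_lborel_cmod_neq[of "1/m"]
    proof eventually_elim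
      case (elim w)
      then have "w \<in> E \<Longrightarrow> w \<in> ?O1 \<or> w \<in> ?O2"
        using sub[of w] by auto
      then show ?case by (auto simp: indicator_def h_def)
    qed
  qed (use hint in \<open>auto simp: set_integrable_def\<close>)
  also have "\<dots> = (LINT w:?O1|lborel. h w) + (LINT w:?O2|lborel. h w)"
    unfolding set_lebesgue_integral_def using hint unfolding set_integrable_def
    by (intro Bochner_Integration.integral_add)
  finally show ?thesis using O2 by (simp add: h_def)
qed

text \<open>
  Compare areas with respect to \<open>dA/|w|\<^sup>2\<close>: for \<open>A = {r < |z| < 1}\<close> the images of \<open>A\<close> under \<open>k\<close> and \<open>1/k\<close>
  are disjoint, each has at least the area of \<open>A\<close>, and if \<open>|k'(0)| > 1\<close> and \<open>r\<close> is small, both lie in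
  \<open>{m \<le> |w| \<le> 1/m}\<close> with \<open>m > r\<close>, whose area is too small. The radius \<open>R > 1\<close> makes the
  mean value property of \<open>z k'(z)/k(z)\<close> available up to \<open>|z| = 1\<close>.
\<close>

lemma bieberbach_eilenberg_aux:
  assumes k: "k holomorphic_on ball 0 R" and R: "R > 1" and inj: "inj_on k (ball 0 R)"
    and k0: "k 0 = 0" and ne1: "\<And>z w. z \<in> ball 0 R \<Longrightarrow> w \<in> ball 0 R \<Longrightarrow> k z * k w \<noteq> 1"
  shows "cmod (deriv k 0) \<le> 1"
proof (rule ccontr)
  assume "\<not> ?thesis"
  \<comment> \<open>The strict gap between 1 and \<open>q\<close> later becomes the gap between
    \<open>r\<close> and \<open>m = q * r\<close>; the gap between \<open>q\<close> and
    \<open>|k'(0)|\<close> leaves room for small \<open>z\<close>.\<close>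
  then obtain q where q: "1 < q" "q < cmod (deriv k 0)"
    using dense by (auto simp: not_le)
  have d0: "deriv k 0 \<noteq> 0" using q by auto
  \<comment> \<open>The quotient k(z)/z with its removable singularity filled; injectivity of
    \<open>k\<close> makes it zero-free.\<close>
  define u where "u z = (if z = 0 then deriv k 0 else (k z - k 0) / (z - 0))" for z
  have u: "u holomorphic_on ball 0 R"
    unfolding u_def[abs_def] using R by (intro pole_lemma[OF k]) (auto simp: interior_open)
  have knz: "k z \<noteq> 0" if "z \<in> ball 0 R" "z \<noteq> 0" for z
    using inj that k0 R by (auto simp: inj_on_def)
  have unz: "u z \<noteq> 0" if "z \<in> ball 0 R" for z
    using knz[OF that] d0 by (auto simp: u_def k0)
  have "isCont u 0"
    using holomorphic_on_imp_continuous_on[OF u] R by (simp add: continuous_on_eq_continuous_at)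
  then have "((\<lambda>z. cmod (u z)) \<longlongrightarrow> cmod (u 0)) (at 0)"
    by (intro tendsto_norm) (simp add: isCont_def)
  then have "eventually (\<lambda>z. cmod (u z) > q) (at 0)"
    using q by (intro order_tendstoD) (auto simp: u_def)
  then obtain e where e: "e > 0" "\<And>z. z \<noteq> 0 \<Longrightarrow> cmod z < e \<Longrightarrow> cmod (u z) > q"
    by (auto simp: eventually_at)
  \<comment> \<open>The first bound puts |z| = r where |k(z)| > q|z|; the second gives
    \<open>m \<le> 1/2\<close>.\<close>
  define r where "r = min (e / 2) (1 / (2 * q))"
  define m where "m = q * r"
  have r: "0 < r" "r < e" using e q by (auto simp: r_def)
  have "m \<le> q * (1 / (2 * q))" unfolding m_def r_def using q by (intro mult_left_mono) auto
  then have m1: "m < 1" using q by simp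
  have rm: "r < m" unfolding m_def using q r by simp
  have m: "0 < m" "m < 1" "r < 1" using m1 rm r by auto
  have kr: "m \<le> cmod (k z - k 0)" if "cmod z = r" for z
  proof -
    have "z \<noteq> 0" using that r by auto
    then have "q < cmod (k z / z)" using e(2)[of z] that r by (auto simp: u_def k0)
    then show ?thesis using that r by (simp add: norm_divide field_simps m_def k0)
  qed
  \<comment> \<open>On |z| = r the values of \<open>k\<close> have modulus at least
    \<open>m\<close>, so the open image of \<open>ball 0 r\<close> covers the ball of radius
    \<open>m\<close>. By injectivity \<open>k\<close> cannot enter that ball again on
    \<open>A\<close>.\<close>
  have sub: "ball (k 0) m \<subseteq> k ` ball 0 r"
  proof (rule ball_subset_open_map_image)
    have "closure (ball 0 r) \<subseteq> (ball 0 R :: complex set)"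
      using r m R by auto
    then show "continuous_on (closure (ball 0 r)) k"
      using holomorphic_on_imp_continuous_on[OF k] continuous_on_subset by blast
    have "ball 0 r \<subseteq> (ball 0 R :: complex set)" using m R by auto
    then show "open (k ` interior (ball 0 r))"
      using open_mapping_thm3[OF holomorphic_on_subset[OF k] open_ball inj_on_subset[OF inj]]
      by (simp add: interior_open)
    show "m \<le> cmod (k z - k 0)" if "z \<in> frontier (ball 0 r)" for z
      using that r by (intro kr) simp
  qed (use r m in auto)
  define A where "A = {z :: complex. r < cmod z \<and> cmod z < 1}"
  define h where "h w = 1 / (cmod w)\<^sup>2" for w :: complex
  have opA: "open A"
    unfolding A_def by (intro open_Collect_conj open_Collect_less continuous_intros)
  have AR: "A \<subseteq> ball 0 R" using R by (auto simp: A_def)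
  have A0: "z \<noteq> 0" if "z \<in> A" for z using that r by (auto simp: A_def)
  have kA0: "k z \<noteq> 0" if "z \<in> A" for z using knz AR A0 that by blast
  define k2 where "k2 z = inverse (k z)" for z
  have kA: "k holomorphic_on A" "inj_on k A"
    using k inj AR by (auto intro: holomorphic_on_subset inj_on_subset)
  have k2A: "k2 holomorphic_on A" "inj_on k2 A"
    unfolding k2_def[abs_def] using kA kA0 by (auto simp: inj_on_def intro!: holomorphic_intros)
  have lower: "m \<le> cmod (k z)" if "z \<in> A" for z
  proof (rule ccontr)
    assume "\<not> ?thesis"
    then obtain z' where z': "z' \<in> ball 0 r" "k z = k z'" using sub k0 by force
    then have "z' \<in> ball 0 R" using m R by auto
    then have "z = z'" using z' inj AR that by (auto simp: inj_on_def)
    then show False using that z' by (auto simp: A_def)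
  qed
  \<comment> \<open>If \<open>k z\<close> were larger, its inverse would lie in the covered ball and
    be a value \<open>k z'\<close>, contradicting \<open>k z * k z' \<noteq> 1\<close>.\<close>
  have upper: "cmod (k z) \<le> 1 / m" if "z \<in> A" for z
  proof (rule ccontr)
    assume "\<not> ?thesis"
    moreover have "0 < cmod (k z)" using kA0[OF that] by simp
    ultimately have "inverse (cmod (k z)) < m" using m by (simp add: field_simps del: zero_less_norm_iff)
    then have "cmod (inverse (k z)) < m" by (simp only: norm_inverse)
    then obtain z' where z': "z' \<in> ball 0 r" "inverse (k z) = k z'" using sub k0 by force
    then have "z' \<in> ball 0 R" using m R by auto
    moreover have "k z * k z' = 1" using z'(2)[symmetric] kA0[OF that] by simp
    ultimately show False using ne1 that AR by blast
  qed
  let ?E1 = "k ` A" and ?E2 = "k2 ` A"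
  have opE: "open ?E1" "open ?E2"
    using open_mapping_thm3 kA k2A opA by blast+
  have disj: "?E1 \<inter> ?E2 = {}"
  proof (rule ccontr)
    assume "\<not> ?thesis"
    then obtain z z' where z: "z \<in> A" "z' \<in> A" "k z = inverse (k z')" by (auto simp: k2_def)
    then have "k z * k z' = 1" using kA0 by simp
    then show False using ne1 z AR by blast
  qed
  have E12: "m \<le> cmod w \<and> cmod w \<le> 1 / m" if "w \<in> ?E1 \<union> ?E2" for w
  proof -
    from that obtain z where z: "z \<in> A" "w = k z \<or> w = inverse (k z)" by (auto simp: k2_def)
    have "0 < cmod (k z)" using kA0[OF z(1)] by simp
    then have "m \<le> inverse (cmod (k z)) \<and> inverse (cmod (k z)) \<le> 1 / m"
      using lower[OF z(1)] upper[OF z(1)] m by (simp add: field_simps del: zero_less_norm_iff)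
    then show ?thesis
      using z(2) lower[OF z(1)] upper[OF z(1)] by (auto simp only: norm_inverse)
  qed
  have hE: "set_integrable lborel ?E1 h" "set_integrable lborel ?E2 h"
    unfolding h_def using set_integrable_inverse_square[of ?E1 m "1/m"] set_integrable_inverse_square[of ?E2 m "1/m"]
      opE E12 m by auto
  have hA: "set_integrable lborel A h"
    unfolding h_def using opA m r by (intro set_integrable_inverse_square[of A r 1]) (auto simp: A_def)
  \<comment> \<open>This is z k'(z)/k(z), written through \<open>u\<close> to be holomorphic at 0
    too, with value 1 there.\<close>
  define F where "F z = deriv k z / u z" for z
  have F: "F holomorphic_on ball 0 R"
    unfolding F_def by (intro holomorphic_intros u unz holomorphic_deriv[OF k]) auto
  have F0: "F 0 = 1" using d0 by (simp add: F_def u_def)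
  have conth: "continuous_on E h" if "0 \<notin> E" for E
    unfolding h_def using that by (intro continuous_intros) auto
  have E0: "0 \<notin> ?E1" "0 \<notin> ?E2" using kA0 by (auto simp: k2_def)
  have integrand1: "(cmod (deriv k z))\<^sup>2 * h (k z) = h z * (cmod (F z))\<^sup>2" if "z \<in> A" for z
    using A0[OF that] kA0[OF that] by (simp add: F_def u_def k0 h_def norm_divide norm_mult power_divide power_mult_distrib)
  \<comment> \<open>Inversion only changes the sign of z k'(z)/k(z), so \<open>k\<close> and
    \<open>k2\<close> pull dA/|w|^2 back to the same density.\<close>
  have integrand2: "(cmod (deriv k2 z))\<^sup>2 * h (k2 z) = h z * (cmod (F z))\<^sup>2" if "z \<in> A" for z
  proof -
    have "(k has_field_derivative deriv k z) (at z)"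
      using kA(1) opA that by (rule holomorphic_derivI)
    then have "(k2 has_field_derivative - (inverse (k z) * deriv k z * inverse (k z))) (at z)"
      unfolding k2_def using kA0[OF that] by (rule DERIV_inverse')
    then have "deriv k2 z = - (inverse (k z) * deriv k z * inverse (k z))"
      by (rule DERIV_imp_deriv)
    then have n: "cmod (deriv k2 z) = inverse (cmod (k z)) * cmod (deriv k z) * inverse (cmod (k z))"
      by (simp only: norm_minus_cancel norm_mult norm_inverse)
    have n2: "cmod (k2 z) = inverse (cmod (k z))"
      by (simp only: k2_def norm_inverse)
    have "cmod (F z) = cmod (deriv k z) * cmod z / cmod (k z)"
      using A0[OF that] by (simp add: F_def u_def k0 norm_divide norm_mult)
    then show ?thesis
      using A0[OF that] kA0[OF that] unfolding h_def n n2 by (simp add: field_simps power2_eq_square)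
  qed
  let ?I = "LINT z:A|lborel. h z * (cmod (F z))\<^sup>2"
  have I1: "(LINT w:?E1|lborel. h w) = ?I"
    unfolding holomorphic_change_of_variables_real(2)[OF opA kA conth[OF E0(1)]]
    using opA integrand1 by (intro set_lebesgue_integral_cong) auto
  have I2: "(LINT w:?E2|lborel. h w) = ?I"
    unfolding holomorphic_change_of_variables_real(2)[OF opA k2A conth[OF E0(2)]]
    using opA integrand2 by (intro set_lebesgue_integral_cong) auto
  have Iint: "set_integrable lborel A (\<lambda>z. h z * (cmod (F z))\<^sup>2)"
  proof -
    have "set_integrable lborel A (\<lambda>z. (cmod (deriv k z))\<^sup>2 * h (k z))"
      using hE(1) holomorphic_change_of_variables_real(1)[OF opA kA conth[OF E0(1)]] by blast
    then show ?thesis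
      by (subst set_integrable_cong[OF refl refl]) (use integrand1 in auto)
  qed
  have rot: "set_integrable lborel A (\<lambda>z. complex_of_real (h z) * F z)"
      "(LINT z:A|lborel. complex_of_real (h z) * F z) = F 0 * (LINT z:A|lborel. complex_of_real (h z))"
  proof -
    have c: "continuous_on A (\<lambda>z. complex_of_real (h z))"
      using A0 by (intro continuous_intros conth) auto
    have i: "set_integrable lborel A (\<lambda>z. complex_of_real (h z))"
      using hA by (simp only: set_integrable_of_real_iff)
    show "set_integrable lborel A (\<lambda>z. complex_of_real (h z) * F z)"
      "(LINT z:A|lborel. complex_of_real (h z) * F z) = F 0 * (LINT z:A|lborel. complex_of_real (h z))"
      by (rule set_integral_rotation_holomorphic[where \<rho> = 1, OF opA _ c _ i _ _ R F];
          auto simp: A_def h_def norm_mult)+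
  qed
  have ReF: "set_integrable lborel A (\<lambda>z. h z * Re (F z))"
      "(LINT z:A|lborel. h z * Re (F z)) = (LINT z:A|lborel. h z)"
    using set_integral_Re[OF rot(1)] unfolding rot(2) F0 by (simp_all add: set_integral_complex_of_real)
  \<comment> \<open>From |F|^2 \<ge> 2 Re F - 1 and the weighted mean 1 of Re F over
    \<open>A\<close>, neither image has smaller dA/|w|^2-area than \<open>A\<close>.\<close>
  have "(LINT z:A|lborel. 2 * (h z * Re (F z)) - h z) \<le> ?I"
  proof (rule set_integral_mono[OF _ Iint])
    show "set_integrable lborel A (\<lambda>z. 2 * (h z * Re (F z)) - h z)"
      using ReF(1) hA by (intro set_integral_diff(1)) auto
    fix z
    have "0 \<le> (Re (F z) - 1)\<^sup>2 + (Im (F z))\<^sup>2" by simp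
    also have "\<dots> = (cmod (F z))\<^sup>2 - (2 * Re (F z) - 1)"
      unfolding cmod_power2 by (simp add: power2_eq_square algebra_simps)
    finally have "h z * (2 * Re (F z) - 1) \<le> h z * (cmod (F z))\<^sup>2"
      by (intro mult_left_mono) (auto simp: h_def)
    then show "2 * (h z * Re (F z)) - h z \<le> h z * (cmod (F z))\<^sup>2"
      by (simp add: algebra_simps)
  qed
  moreover have "(LINT z:A|lborel. 2 * (h z * Re (F z)) - h z) = (LINT z:A|lborel. h z)"
    using ReF hA by (subst set_integral_diff(2)) auto
  ultimately have LI: "(LINT z:A|lborel. h z) \<le> ?I" by simp
  let ?O = "{w :: complex. m < cmod w \<and> cmod w < 1}"
  have opO: "open ?O"
    by (intro open_Collect_conj open_Collect_less continuous_intros)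
  have hO: "set_integrable lborel ?O h"
    unfolding h_def using opO m by (intro set_integrable_inverse_square[of _ m 1]) auto
  have "(LINT w:?E1 \<union> ?E2|lborel. h w) \<le> 2 * (LINT w:?O|lborel. h w)"
    unfolding h_def using set_integral_inverse_square_annulus_le[of "?E1 \<union> ?E2" m] E12 opE m by auto
  moreover have "(LINT w:?E1 \<union> ?E2|lborel. h w) = ?I + ?I"
    using set_integral_Un[OF disj hE] I1 I2 by simp
  ultimately have IO: "?I \<le> (LINT w:?O|lborel. h w)" by simp
  \<comment> \<open>A disc of positive mass inside \<open>r < |w| < m\<close>: it makes the annulus
    \<open>m < |w| < 1\<close> strictly smaller in mass than \<open>A\<close>.\<close>
  define Q where "Q = ball (complex_of_real ((r + m) / 2)) ((m - r) / 2)"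
  have Q: "r < cmod w \<and> cmod w < m" if "w \<in> Q" for w
  proof -
    have d: "cmod (complex_of_real ((r + m) / 2) - w) < (m - r) / 2" using that by (simp add: Q_def dist_norm)
    have n: "cmod (complex_of_real ((r + m) / 2)) = (r + m) / 2" using m r by (simp only: norm_of_real) simp
    have "cmod w \<le> (r + m) / 2 + cmod (complex_of_real ((r + m) / 2) - w)"
      "(r + m) / 2 \<le> cmod w + cmod (complex_of_real ((r + m) / 2) - w)"
      using norm_triangle_ineq4[of "complex_of_real ((r + m) / 2)" "complex_of_real ((r + m) / 2) - w"]
        norm_triangle_ineq[of w "complex_of_real ((r + m) / 2) - w"] n by auto
    then show ?thesis using d by (auto simp: field_simps)
  qed
  have hQ: "set_integrable lborel Q h"
    unfolding h_def using Q r by (intro set_integrable_inverse_square[of _ r m]) (auto simp: Q_def less_imp_le)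
  have Q1: "set_integrable lborel Q (\<lambda>w. 1 :: real)"
    by (intro set_integrable_const_bounded) (auto simp: Q_def)
  have "0 < measure lborel Q"
    using rm by (simp add: Q_def)
  also have "measure lborel Q = (LINT w:Q|lborel. 1)"
    by (simp add: set_lebesgue_integral_def Q_def)
  also have "\<dots> \<le> (LINT w:Q|lborel. h w)"
  proof (rule set_integral_mono[OF Q1 hQ])
    fix w assume "w \<in> Q"
    then have "0 < cmod w" "cmod w \<le> 1" using Q[of w] r m by linarith+
    then show "1 \<le> h w" by (simp add: h_def power_le_one)
  qed
  finally have "(LINT w:?O|lborel. h w) < (LINT w:?O|lborel. h w) + (LINT w:Q|lborel. h w)" by simp
  also have "\<dots> = (LINT w:?O \<union> Q|lborel. h w)"
    using Q by (intro set_integral_Un[symmetric] hO hQ) force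
  also have "\<dots> \<le> (LINT w:A|lborel. h w)"
    unfolding set_lebesgue_integral_def
  proof (rule integral_mono)
    show "integrable lborel (\<lambda>w. indicator (?O \<union> Q) w *\<^sub>R h w)"
      using set_integrable_Un[OF hO hQ] opO by (auto simp: set_integrable_def Q_def)
    have "?O \<union> Q \<subseteq> A"
      using Q rm m by (auto simp: A_def intro: less_trans)
    then show "indicator (?O \<union> Q) w *\<^sub>R h w \<le> indicator A w *\<^sub>R h w" for w
      by (auto simp: indicator_def h_def)
  qed (use hA in \<open>simp add: set_integrable_def\<close>)
  finally show False using LI IO by simp
qed

text \<open>For \<rho> < 1 the dilation \<open>k (\<rho> z)\<close> is defined on the disc of radius
  1/\<rho> > 1, where the preceding case applies and gives \<rho> |k'(0)| \<le> 1.\<close>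

lemma bieberbach_eilenberg:
  assumes k: "k holomorphic_on ball 0 1" and inj: "inj_on k (ball 0 1)"
    and k0: "k 0 = 0" and ne1: "\<And>z w. z \<in> ball 0 1 \<Longrightarrow> w \<in> ball 0 1 \<Longrightarrow> k z * k w \<noteq> 1"
  shows "cmod (deriv k 0) \<le> 1"
proof (rule dense_le)
  fix y assume y: "y < cmod (deriv k 0)"
  have le: "\<rho> * cmod (deriv k 0) \<le> 1" if \<rho>: "0 < \<rho>" "\<rho> < 1" for \<rho>
  proof -
    define l where "l z = k (of_real \<rho> * z)" for z
    have im: "(*) (of_real \<rho>) ` ball 0 (1 / \<rho>) \<subseteq> (ball 0 1 :: complex set)"
      using \<rho> by (auto simp: norm_mult field_simps)
    then have mem: "of_real \<rho> * z \<in> ball 0 1" if "z \<in> ball 0 (1 / \<rho>)" for z :: complex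
      using that by blast
    have der: "(k has_field_derivative deriv k 0) (at 0)"
      using k by (intro holomorphic_derivI[of _ "ball 0 1"]) auto
    have "(l has_field_derivative deriv k 0 * of_real \<rho>) (at 0)"
      unfolding l_def[abs_def] by (rule DERIV_chain2) (auto intro!: der derivative_eq_intros)
    then have "deriv l 0 = deriv k 0 * of_real \<rho>" by (rule DERIV_imp_deriv)
    moreover have "cmod (deriv l 0) \<le> 1"
    proof (rule bieberbach_eilenberg_aux)
      have "k \<circ> (*) (of_real \<rho>) holomorphic_on ball 0 (1 / \<rho>)"
        by (rule holomorphic_on_compose_gen[OF _ k im]) (intro holomorphic_intros)
      then show "l holomorphic_on ball 0 (1 / \<rho>)" by (simp add: l_def[abs_def] o_def)
      show "inj_on l (ball 0 (1 / \<rho>))"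
      proof (rule inj_onI)
        fix x y assume xy: "x \<in> ball 0 (1 / \<rho>)" "y \<in> ball 0 (1 / \<rho>)" "l x = l y"
        then have "of_real \<rho> * x = of_real \<rho> * y"
          using im unfolding l_def by (auto dest!: inj_onD[OF inj])
        then show "x = y" using \<rho> by simp
      qed
      show "l z * l w \<noteq> 1" if "z \<in> ball 0 (1 / \<rho>)" "w \<in> ball 0 (1 / \<rho>)" for z w
        unfolding l_def by (rule ne1[OF mem[OF that(1)] mem[OF that(2)]])
    qed (use \<rho> k0 in \<open>auto simp: l_def\<close>)
    ultimately show ?thesis using \<rho> by (simp add: norm_mult mult.commute)
  qed
  show "y \<le> 1"
  proof (rule ccontr)
    assume "\<not> ?thesis"
    then have "y > 1" by simp
    \<comment> \<open>The dilation factor 1/y would give |k'(0)| \<le> y, against the choice of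
      \<open>y\<close>.\<close>
    then have "inverse y * cmod (deriv k 0) \<le> 1" using y by (intro le) (auto simp: field_simps)
    then show False using \<open>y > 1\<close> y by (simp add: field_simps)
  qed
qed

section \<open>Distance to an omitted value\<close>

text \<open>The transform \<open>k = (g - g 0) / (g + g 0)\<close> vanishes at 0 and has derivative
  \<open>g'(0) / (2 g(0))\<close> there; the equation \<open>k z * k w = 1\<close> would mean
  \<open>g z + g w = 0\<close>. So the Bieberbach--Eilenberg inequality applies to
  \<open>k\<close>.\<close>

lemma Gelfer_deriv_bound:
  assumes g: "g holomorphic_on ball 0 1" and inj: "inj_on g (ball 0 1)"
    and ne: "\<And>z w. z \<in> ball 0 1 \<Longrightarrow> w \<in> ball 0 1 \<Longrightarrow> g z + g w \<noteq> 0"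
  shows "cmod (deriv g 0) \<le> 2 * cmod (g 0)"
proof -
  have a: "g z + g 0 \<noteq> 0" if "z \<in> ball 0 1" for z using ne that by simp
  have a0: "g 0 \<noteq> 0" using a[of 0] by auto
  define k where "k z = (g z - g 0) / (g z + g 0)" for z
  have der: "(g has_field_derivative deriv g 0) (at 0)"
    using g by (intro holomorphic_derivI[of _ "ball 0 1"]) auto
  have "(k has_field_derivative (deriv g 0 * (g 0 + g 0) - (g 0 - g 0) * deriv g 0) / ((g 0 + g 0) * (g 0 + g 0))) (at 0)"
    unfolding k_def[abs_def] using a0 by (auto intro!: derivative_eq_intros der)
  then have "deriv k 0 = deriv g 0 * (2 * g 0) / ((2 * g 0) * (2 * g 0))"
    unfolding mult_2 by (intro DERIV_imp_deriv) simp
  then have "deriv k 0 = deriv g 0 / (2 * g 0)"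
    using a0 by simp
  moreover have "cmod (deriv k 0) \<le> 1"
  proof (rule bieberbach_eilenberg)
    show "k holomorphic_on ball 0 1"
      unfolding k_def[abs_def] by (intro holomorphic_intros g a)
    show "inj_on k (ball 0 1)"
    proof (rule inj_onI)
      fix x y assume xy: "x \<in> ball 0 1" "y \<in> ball 0 1" "k x = k y"
      then have "(g x - g 0) * (g y + g 0) = (g y - g 0) * (g x + g 0)"
        using a[of x] a[of y] by (simp add: k_def frac_eq_eq)
      then have "2 * g 0 * (g x - g y) = 0" by (simp add: algebra_simps)
      then have "g x = g y" using a0 by simp
      then show "x = y" using inj xy by (auto simp: inj_on_def)
    qed
    show "k z * k w \<noteq> 1" if zw: "z \<in> ball 0 1" "w \<in> ball 0 1" for z w
    proof
      assume "k z * k w = 1"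
      then have "(g z - g 0) * (g w - g 0) = (g z + g 0) * (g w + g 0)"
        using a[of z] a[of w] zw by (simp add: k_def divide_simps)
      then have "2 * g 0 * (g z + g w) = 0" by (simp add: algebra_simps)
      then show False using a0 ne[OF zw] by simp
    qed
  qed (simp add: k_def)
  ultimately have "cmod (deriv g 0) / (2 * cmod (g 0)) \<le> 1"
    by (simp add: norm_divide norm_mult)
  moreover have "0 < 2 * cmod (g 0)" using a0 by simp
  ultimately show ?thesis by (simp add: divide_le_eq del: zero_less_norm_iff)
qed

section \<open>Moving the base point by disc automorphisms\<close>

lemma Moebius_has_field_derivative:
  assumes "1 - cnj w * z \<noteq> 0"
  shows "(Moebius_function 0 w has_field_derivative (1 - cnj w * w) / (1 - cnj w * z)\<^sup>2) (at z)"
proof -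
  have "((\<lambda>z. (z - w) / (1 - cnj w * z)) has_field_derivative
      (1 * (1 - cnj w * z) - (z - w) * (- cnj w)) / ((1 - cnj w * z) * (1 - cnj w * z))) (at z)"
    using assms by (intro DERIV_divide) (auto intro!: derivative_eq_intros)
  moreover have "1 * (1 - cnj w * z) - (z - w) * (- cnj w) = 1 - cnj w * w"
    by (simp add: algebra_simps)
  ultimately show ?thesis
    unfolding Moebius_function_simple[abs_def] power2_eq_square by (simp only:)
qed

lemma Moebius_bij_disc:
  assumes "cmod w < 1"
  shows "Moebius_function 0 w ` ball 0 1 = ball 0 1" and "inj_on (Moebius_function 0 w) (ball 0 1)"
proof -
  have inv1: "Moebius_function 0 (-w) (Moebius_function 0 w z) = z" if "z \<in> ball 0 1" for z
    using that assms Moebius_function_compose[of "-w" w z] by auto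
  have inv2: "Moebius_function 0 w (Moebius_function 0 (-w) z) = z" if "z \<in> ball 0 1" for z
    using that assms Moebius_function_compose[of w "-w" z] by auto
  show "inj_on (Moebius_function 0 w) (ball 0 1)"
    by (rule inj_on_inverseI[where g = "Moebius_function 0 (-w)"]) (rule inv1)
  show "Moebius_function 0 w ` ball 0 1 = ball 0 1"
  proof
    show "Moebius_function 0 w ` ball 0 1 \<subseteq> ball 0 1"
      using Moebius_function_norm_lt_1[OF assms] by auto
    show "ball 0 1 \<subseteq> Moebius_function 0 w ` ball 0 1"
    proof
      fix z :: complex assume z: "z \<in> ball 0 1"
      then have "Moebius_function 0 (-w) z \<in> ball 0 1"
        using Moebius_function_norm_lt_1[of "-w" z] assms by auto
      then show "z \<in> Moebius_function 0 w ` ball 0 1" using inv2[OF z] by force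
    qed
  qed
qed

text \<open>Precomposition with the disc automorphism that takes 0 to \<open>a\<close> preserves the
  hypotheses; its derivative at 0 is 1 - |a|^2.\<close>

lemma Gelfer_deriv_bound':
  assumes g: "g holomorphic_on ball 0 1" and inj: "inj_on g (ball 0 1)"
    and ne: "\<And>z w. z \<in> ball 0 1 \<Longrightarrow> w \<in> ball 0 1 \<Longrightarrow> g z + g w \<noteq> 0"
    and a: "a \<in> ball 0 1"
  shows "cmod (deriv g a) * (1 - (cmod a)\<^sup>2) \<le> 2 * cmod (g a)"
proof -
  let ?M = "Moebius_function 0 (-a)"
  have a': "cmod (-a) < 1" using a by simp
  note M = Moebius_bij_disc[OF a']
  have M0: "?M 0 = a" by (simp add: Moebius_function_simple)
  have "(?M has_field_derivative (1 - cnj a * a)) (at 0)"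
    using Moebius_has_field_derivative[of "-a" 0] by simp
  moreover have "(g has_field_derivative deriv g a) (at (?M 0))"
    unfolding M0 using g a by (intro holomorphic_derivI) auto
  ultimately have "((\<lambda>z. g (?M z)) has_field_derivative deriv g a * (1 - cnj a * a)) (at 0)"
    by (intro DERIV_chain2)
  then have d: "deriv (g \<circ> ?M) 0 = deriv g a * (1 - cnj a * a)"
    unfolding o_def by (rule DERIV_imp_deriv)
  have "cmod (deriv (g \<circ> ?M) 0) \<le> 2 * cmod ((g \<circ> ?M) 0)"
  proof (rule Gelfer_deriv_bound)
    show "g \<circ> ?M holomorphic_on ball 0 1"
      using g M(1) Moebius_function_holomorphic[OF a'] by (intro holomorphic_on_compose_gen[where t = "ball 0 1"]) auto
    show "inj_on (g \<circ> ?M) (ball 0 1)"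
      using M inj by (intro comp_inj_on) auto
    show "(g \<circ> ?M) z + (g \<circ> ?M) w \<noteq> 0" if "z \<in> ball 0 1" "w \<in> ball 0 1" for z w
      using that M(1) unfolding o_def by (intro ne) auto
  qed
  moreover have "cmod (1 - cnj a * a) = 1 - (cmod a)\<^sup>2"
  proof -
    have "1 - cnj a * a = of_real (1 - (cmod a)\<^sup>2)"
      by (simp only: of_real_diff of_real_1 complex_norm_square mult.commute)
    moreover have "(cmod a)\<^sup>2 \<le> 1" using a by (auto simp: power_le_one)
    ultimately show ?thesis by (simp only: norm_of_real)
  qed
  ultimately show ?thesis using d M0 by (simp add: norm_mult)
qed

text \<open>With \<open>l\<close> a logarithm of \<open>\<psi> - p\<close> and
  \<open>g = exp (l / 2)\<close>, the Gelfer bound reads |l'(z)| \<le> 4/(1 - |z|^2). Radial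
  integration of Re l gives the factor ((1 - s)/(1 + s))^2 with \<open>s = |\<zeta>|\<close>, and (1
  + s)^2 \<le> 4.\<close>

lemma univalent_dist_omitted_value:
  assumes \<psi>: "\<psi> holomorphic_on ball 0 1" and inj: "inj_on \<psi> (ball 0 1)"
    and p: "p \<notin> \<psi> ` ball 0 1" and \<zeta>: "\<zeta> \<in> ball 0 1"
  shows "dist (\<psi> 0) p * (1 - cmod \<zeta>)\<^sup>2 / 4 \<le> dist (\<psi> \<zeta>) p"
proof -
  have nz: "\<psi> z - p \<noteq> 0" if "z \<in> ball 0 1" for z using p that by force
  have "simply_connected (ball (0::complex) 1)"
    by (simp add: convex_imp_simply_connected)
  moreover have "(\<lambda>z. \<psi> z - p) holomorphic_on ball 0 1" "\<forall>z\<in>ball 0 1. \<psi> z - p \<noteq> 0"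
    using \<psi> nz by (auto intro!: holomorphic_intros)
  ultimately obtain l where l: "l holomorphic_on ball 0 1" "\<And>z. z \<in> ball 0 1 \<Longrightarrow> \<psi> z - p = exp (l z)"
    using simply_connected_eq_holomorphic_log[of "ball (0::complex) 1"] by auto
  define g where "g z = exp (l z / 2)" for z
  have g: "g holomorphic_on ball 0 1"
    unfolding g_def[abs_def] by (intro holomorphic_intros l) auto
  have gsq: "(g z)\<^sup>2 = \<psi> z - p" if "z \<in> ball 0 1" for z
    using l(2)[OF that] by (simp add: g_def exp_double[symmetric])
  have gnz: "g z \<noteq> 0" for z by (simp add: g_def)
  have injsq: "z = w" if "z \<in> ball 0 1" "w \<in> ball 0 1" "(g z)\<^sup>2 = (g w)\<^sup>2" for z w
    using that gsq inj by (auto simp: inj_on_def)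
  have injg: "inj_on g (ball 0 1)"
    using injsq by (auto intro!: inj_onI)
  have ne: "g z + g w \<noteq> 0" if zw: "z \<in> ball 0 1" "w \<in> ball 0 1" for z w
  proof
    assume *: "g z + g w = 0"
    then have "g z = - g w" by (simp add: eq_neg_iff_add_eq_0)
    then have "z = w" using injsq[OF zw] by simp
    then show False using * gnz[of w] by simp
  qed
  have dl: "cmod (deriv l z) \<le> 4 / (1 - (cmod z)\<^sup>2)" if z: "z \<in> ball 0 1" for z
  proof -
    have "(l has_field_derivative deriv l z) (at z)"
      using l(1) z by (intro holomorphic_derivI) auto
    then have "(g has_field_derivative g z * (deriv l z / 2)) (at z)"
      unfolding g_def[abs_def] by (auto intro!: derivative_eq_intros)
    then have d: "deriv g z = g z * (deriv l z / 2)" by (rule DERIV_imp_deriv)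
    have "(cmod z)\<^sup>2 < 1" using z by (auto simp: power_less_one_iff abs_square_less_1)
    moreover have "cmod (g z) * (cmod (deriv l z) / 2 * (1 - (cmod z)\<^sup>2)) \<le> cmod (g z) * 2"
      using Gelfer_deriv_bound'[OF g injg ne z] unfolding d by (simp add: norm_mult norm_divide mult_ac)
    then have "cmod (deriv l z) / 2 * (1 - (cmod z)\<^sup>2) \<le> 2"
      using gnz[of z] by simp
    ultimately show ?thesis by (simp add: field_simps)
  qed
  define s where "s = cmod \<zeta>"
  have s: "0 \<le> s" "s < 1" using \<zeta> by (auto simp: s_def)
  \<comment> \<open>The radial direction; it is 0 for \<open>\<zeta> = 0\<close>, hence only an
    upper bound on its modulus is stated.\<close>
  define v where "v = sgn \<zeta>"
  have v: "cmod v \<le> 1" by (simp add: v_def norm_sgn)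
  have sv: "of_real s * v = \<zeta>"
    by (cases "\<zeta> = 0") (simp_all add: v_def s_def sgn_eq)
  \<comment> \<open>The added term is the antiderivative of 4/(1 - x^2) vanishing at 0, so the bound
    on \<open>deriv l\<close> makes \<open>G\<close> nondecreasing.\<close>
  define G where "G x = Re (l (of_real x * v)) + (2 * ln (1 + x) - 2 * ln (1 - x))" for x
  have ball: "of_real x * v \<in> ball 0 1" if "0 \<le> x" "x < 1" for x
  proof -
    have "x * cmod v \<le> x * 1" using v that by (intro mult_left_mono) auto
    then show ?thesis using that by (simp add: norm_mult)
  qed
  have "G 0 \<le> G s"
  proof (rule DERIV_nonneg_imp_nondecreasing[OF s(1)])
    fix x assume "0 \<le> x" "x \<le> s"
    then have x: "0 \<le> x" "x < 1" using s by auto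
    let ?z = "of_real x * v"
    have "(l has_field_derivative deriv l ?z) (at ?z)"
      using l(1) ball[OF x] by (intro holomorphic_derivI) auto
    then have "((\<lambda>z. l (z * v)) has_field_derivative deriv l ?z * v) (at (of_real x))"
      by (rule DERIV_chain2) (auto intro!: derivative_eq_intros)
    then have "((\<lambda>x. l (of_real x * v)) has_vector_derivative deriv l ?z * v) (at x)"
      using has_field_derivative_subset has_vector_derivative_real_field by blast
    then have "((\<lambda>x. Re (l (of_real x * v))) has_vector_derivative Re (deriv l ?z * v)) (at x)"
      by (rule bounded_linear.has_vector_derivative[OF bounded_linear_Re])
    then have "((\<lambda>x. Re (l (of_real x * v))) has_real_derivative Re (deriv l ?z * v)) (at x)"
      by (simp add: has_real_derivative_iff_has_vector_derivative)
    moreover have "((\<lambda>x. 2 * ln (1 + x) - 2 * ln (1 - x)) has_real_derivative (2 / (1 + x) + 2 / (1 - x))) (at x)"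
      using x by (auto intro!: derivative_eq_intros)
    ultimately have "(G has_real_derivative Re (deriv l ?z * v) + (2 / (1 + x) + 2 / (1 - x))) (at x)"
      unfolding G_def[abs_def] by (rule DERIV_add)
    moreover have "0 \<le> Re (deriv l ?z * v) + (2 / (1 + x) + 2 / (1 - x))"
    proof -
      have "- Re (deriv l ?z * v) \<le> cmod (deriv l ?z * v)"
        using abs_Re_le_cmod[of "deriv l ?z * v"] by linarith
      also have "\<dots> \<le> cmod (deriv l ?z) * 1"
        unfolding norm_mult using v by (intro mult_left_mono) auto
      also have "\<dots> \<le> 4 / (1 - (cmod ?z)\<^sup>2)" using dl[OF ball[OF x]] by simp
      also have "\<dots> \<le> 4 / (1 - x\<^sup>2)"
      proof (rule divide_left_mono)
        have "cmod ?z \<le> x" using v x by (simp add: norm_mult mult_left_le)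
        then have "(cmod ?z)\<^sup>2 \<le> x\<^sup>2" by (intro power_mono) auto
        moreover have "x\<^sup>2 < 1" using x by (simp add: abs_square_less_1)
        ultimately show "1 - x\<^sup>2 \<le> 1 - (cmod ?z)\<^sup>2" "0 < (1 - (cmod ?z)\<^sup>2) * (1 - x\<^sup>2)"
          by auto
      qed auto
      also have "\<dots> = 2 / (1 + x) + 2 / (1 - x)"
      proof -
        have f: "1 - x\<^sup>2 = (1 + x) * (1 - x)" by (simp add: algebra_simps power2_eq_square)
        have "1 + x \<noteq> 0" "1 - x \<noteq> 0" using x by auto
        then show ?thesis unfolding f by (simp add: add_frac_eq)
      qed
      finally show ?thesis by simp
    qed
    ultimately show "\<exists>y. (G has_real_derivative y) (at x) \<and> 0 \<le> y" by blast
  qed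
  then have "Re (l 0) \<le> Re (l \<zeta>) + 2 * ln (1 + s) - 2 * ln (1 - s)"
    by (simp add: G_def sv)
  then have "exp (Re (l 0)) \<le> exp (Re (l \<zeta>) + 2 * ln (1 + s) - 2 * ln (1 - s))" by simp
  also have "\<dots> = exp (Re (l \<zeta>)) * (1 + s)\<^sup>2 / (1 - s)\<^sup>2"
    using s by (simp add: exp_add exp_diff exp_double)
  finally have "exp (Re (l 0)) * (1 - s)\<^sup>2 \<le> exp (Re (l \<zeta>)) * (1 + s)\<^sup>2"
    using s by (simp add: field_simps)
  also have "\<dots> \<le> exp (Re (l \<zeta>)) * 2\<^sup>2"
    using s by (intro mult_left_mono power_mono) auto
  finally show ?thesis
    using l(2)[OF \<zeta>] l(2)[of 0] by (simp add: dist_norm s_def norm_exp_eq_Re)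
qed

section \<open>Bergman kernels\<close>

lemma set_borel_measurable_continuous_open:
  fixes f :: "complex \<Rightarrow> 'b::real_normed_vector"
  assumes "open S" "continuous_on S f"
  shows "set_borel_measurable lborel S f"
  unfolding set_borel_measurable_def
  using borel_measurable_continuous_on_indicator[OF _ assms(2)] assms(1) by auto

section \<open>The Bergman space and its inner product\<close>

lemma bergman_spaceD:
  assumes "f \<in> bergman_space \<Omega>"
  shows "f holomorphic_on \<Omega>" "set_integrable lborel \<Omega> (\<lambda>z. (cmod (f z))\<^sup>2)" "continuous_on \<Omega> f"
  using assms holomorphic_on_imp_continuous_on by (auto simp: bergman_space_def)

lemma bergman_space_add:
  assumes \<Omega>: "open \<Omega>" and f: "f \<in> bergman_space \<Omega>" and g: "g \<in> bergman_space \<Omega>"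
  shows "(\<lambda>z. f z + c * g z) \<in> bergman_space \<Omega>"
  unfolding bergman_space_def
proof (intro CollectI conjI)
  note f' = bergman_spaceD[OF f] and g' = bergman_spaceD[OF g]
  show "(\<lambda>z. f z + c * g z) holomorphic_on \<Omega>"
    by (intro holomorphic_intros f' g')
  show "set_integrable lborel \<Omega> (\<lambda>z. (cmod (f z + c * g z))\<^sup>2)"
  proof (rule set_integrable_bound)
    show "set_integrable lborel \<Omega> (\<lambda>z. 2 * (cmod (f z))\<^sup>2 + 2 * (cmod c)\<^sup>2 * (cmod (g z))\<^sup>2)"
      by (intro set_integral_add(1) set_integrable_mult_right f' g')
    show "set_borel_measurable lborel \<Omega> (\<lambda>z. (cmod (f z + c * g z))\<^sup>2)"
      by (intro set_borel_measurable_continuous_open \<Omega> continuous_intros f' g')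
    show "AE z in lborel. z \<in> \<Omega> \<longrightarrow> norm ((cmod (f z + c * g z))\<^sup>2) \<le>
        norm (2 * (cmod (f z))\<^sup>2 + 2 * (cmod c)\<^sup>2 * (cmod (g z))\<^sup>2)"
    proof (intro AE_I2 impI)
      fix z
      have "(cmod (f z + c * g z))\<^sup>2 \<le> (cmod (f z) + cmod (c * g z))\<^sup>2"
        by (intro power_mono norm_triangle_ineq) auto
      also have "\<dots> \<le> 2 * (cmod (f z))\<^sup>2 + 2 * (cmod (c * g z))\<^sup>2"
        using sum_squares_bound[of "cmod (f z)" "cmod (c * g z)"] by (simp add: power2_sum)
      finally show "norm ((cmod (f z + c * g z))\<^sup>2) \<le>
          norm (2 * (cmod (f z))\<^sup>2 + 2 * (cmod c)\<^sup>2 * (cmod (g z))\<^sup>2)"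
        by (simp add: norm_mult power_mult_distrib)
    qed
  qed
qed

lemma bergman_space_scale:
  assumes "open \<Omega>" "f \<in> bergman_space \<Omega>"
  shows "(\<lambda>z. c * f z) \<in> bergman_space \<Omega>"
proof -
  have "(\<lambda>_. 0) \<in> bergman_space \<Omega>"
    by (simp add: bergman_space_def set_integrable_def)
  from bergman_space_add[OF assms(1) this assms(2)] show ?thesis by simp
qed

lemma bergman_space_subset:
  assumes "f \<in> bergman_space \<Omega>" "open D" "D \<subseteq> \<Omega>"
  shows "f \<in> bergman_space D"
  using assms set_integrable_subset[of lborel \<Omega> _ D] by (auto simp: bergman_space_def intro: holomorphic_on_subset)

lemma bergman_space_mult_integrable:
  assumes \<Omega>: "open \<Omega>" and f: "f \<in> bergman_space \<Omega>" and g: "g \<in> bergman_space \<Omega>"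
  shows "set_integrable lborel \<Omega> (\<lambda>z. f z * cnj (g z))"
proof (rule set_integrable_bound)
  note f' = bergman_spaceD[OF f] and g' = bergman_spaceD[OF g]
  show "set_integrable lborel \<Omega> (\<lambda>z. (cmod (f z))\<^sup>2 + (cmod (g z))\<^sup>2)"
    by (intro set_integral_add(1) f' g')
  show "set_borel_measurable lborel \<Omega> (\<lambda>z. f z * cnj (g z))"
    by (intro set_borel_measurable_continuous_open \<Omega> continuous_intros f' g')
  show "AE z in lborel. z \<in> \<Omega> \<longrightarrow> norm (f z * cnj (g z)) \<le> norm ((cmod (f z))\<^sup>2 + (cmod (g z))\<^sup>2)"
  proof (intro AE_I2 impI)
    fix z
    have "2 * cmod (f z) * cmod (g z) \<le> (cmod (f z))\<^sup>2 + (cmod (g z))\<^sup>2"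
      by (rule sum_squares_bound)
    moreover have "0 \<le> cmod (f z) * cmod (g z)" by simp
    ultimately have "norm (f z * cnj (g z)) \<le> (cmod (f z))\<^sup>2 + (cmod (g z))\<^sup>2"
      unfolding norm_mult complex_mod_cnj mult.assoc by linarith
    then show "norm (f z * cnj (g z)) \<le> norm ((cmod (f z))\<^sup>2 + (cmod (g z))\<^sup>2)"
      by simp
  qed
qed

section \<open>The kernel expressed through a Riemann map\<close>

lemma deriv_in_bergman_space:
  assumes \<Omega>: "open \<Omega>" and \<phi>: "\<phi> holomorphic_on \<Omega>" "inj_on \<phi> \<Omega>" "bounded (\<phi> ` \<Omega>)"
  shows "deriv \<phi> \<in> bergman_space \<Omega>"
proof -
  have "open (\<phi> ` \<Omega>)" using open_mapping_thm3[OF \<phi>(1) \<Omega> \<phi>(2)] .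
  then have "set_integrable lborel (\<phi> ` \<Omega>) (\<lambda>_. 1 :: real)"
    by (intro set_integrable_const_bounded \<phi>(3)) auto
  \<comment> \<open>The squared norm of \<open>deriv \<phi>\<close> is the area of the image of
    \<phi>.\<close>
  then have "set_integrable lborel \<Omega> (\<lambda>z. (cmod (deriv \<phi> z))\<^sup>2)"
    using holomorphic_change_of_variables_real(1)[OF \<Omega> \<phi>(1,2), of "\<lambda>_. 1"] by simp
  then show ?thesis
    using \<Omega> \<phi> by (auto simp: bergman_space_def intro: holomorphic_deriv)
qed

text \<open>Pulled back to the disc by \<psi>, the inverse of \<phi>, the integral becomes that of
  the holomorphic function \<open>H = (f \<circ> \<psi>) * deriv \<psi>\<close>, and the mean value
  property evaluates it at 0. Up to a constant, \<open>deriv \<phi>\<close> is therefore the kernel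
  at the zero of \<phi>.\<close>

lemma bergman_integral_centered:
  assumes \<Omega>: "open \<Omega>" and \<phi>: "\<phi> holomorphic_on \<Omega>" "inj_on \<phi> \<Omega>" "\<phi> ` \<Omega> = ball 0 1"
    and w: "w \<in> \<Omega>" "\<phi> w = 0" and f: "f \<in> bergman_space \<Omega>"
  shows "(LINT z:\<Omega>|lborel. f z * cnj (deriv \<phi> z)) = of_real pi * f w / deriv \<phi> w"
proof -
  obtain \<psi> where \<psi>: "\<psi> holomorphic_on \<phi> ` \<Omega>" "\<And>z. z \<in> \<Omega> \<Longrightarrow> deriv \<phi> z * deriv \<psi> (\<phi> z) = 1"
      "\<And>z. z \<in> \<Omega> \<Longrightarrow> \<psi> (\<phi> z) = z"
    using holomorphic_has_inverse[OF \<phi>(1) \<Omega> \<phi>(2)] by blast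
  define H where "H \<zeta> = f (\<psi> \<zeta>) * deriv \<psi> \<zeta>" for \<zeta>
  have "f \<circ> \<psi> holomorphic_on ball 0 1"
    using \<psi> \<phi>(3) by (intro holomorphic_on_compose_gen[OF _ bergman_spaceD(1)[OF f]]) force+
  then have H: "H holomorphic_on ball 0 1"
    using \<psi>(1) \<phi>(3) unfolding H_def[abs_def] o_def by (auto intro!: holomorphic_intros holomorphic_deriv)
  then have contH: "continuous_on (\<phi> ` \<Omega>) H"
    unfolding \<phi>(3) by (rule holomorphic_on_imp_continuous_on)
  have integrand: "of_real ((cmod (deriv \<phi> z))\<^sup>2) * H (\<phi> z) = f z * cnj (deriv \<phi> z)" if "z \<in> \<Omega>" for z
  proof -
    have "of_real ((cmod (deriv \<phi> z))\<^sup>2) * H (\<phi> z) = (deriv \<phi> z * deriv \<psi> (\<phi> z)) * (f z * cnj (deriv \<phi> z))"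
      unfolding complex_norm_square H_def using \<psi>(3)[OF that] by simp
    then show ?thesis using \<psi>(2)[OF that] by simp
  qed
  note cv = holomorphic_change_of_variables[OF \<Omega> \<phi>(1,2) contH]
  have "set_integrable lborel \<Omega> (\<lambda>z. f z * cnj (deriv \<phi> z))"
    using \<phi> \<Omega> by (intro bergman_space_mult_integrable f deriv_in_bergman_space) auto
  then have "set_integrable lborel \<Omega> (\<lambda>z. of_real ((cmod (deriv \<phi> z))\<^sup>2) * H (\<phi> z))"
    by (subst set_integrable_cong[OF refl refl integrand]) auto
  then have "set_integrable lborel (ball 0 1) H"
    using cv(1) unfolding \<phi>(3) by blast
  then have "(LINT \<zeta>:ball 0 1|lborel. H \<zeta>) = of_real pi * H 0"
    by (intro disc_mean_value H)
  moreover have "(LINT \<zeta>:ball 0 1|lborel. H \<zeta>) = (LINT z:\<Omega>|lborel. f z * cnj (deriv \<phi> z))"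
    using cv(2) \<Omega> integrand unfolding \<phi>(3) by (auto intro!: set_lebesgue_integral_cong)
  moreover have "H 0 = f w / deriv \<phi> w"
  proof -
    have "deriv \<phi> w * deriv \<psi> 0 = 1" "\<psi> 0 = w"
      using \<psi>(2,3)[OF w(1)] unfolding w(2) by auto
    then have "deriv \<psi> 0 = 1 / deriv \<phi> w"
      by (metis div_by_1 mult_eq_0_iff nonzero_mult_div_cancel_left zero_neq_one)
    then show ?thesis unfolding H_def \<open>\<psi> 0 = w\<close> by simp
  qed
  ultimately show ?thesis by simp
qed

text \<open>The Bergman kernel 1/(\<pi> (1 - z cnj w)^2) of the unit disc, transported by the
  transformation rule for conformal maps.\<close>

definition disc_pullback_kernel :: "(complex \<Rightarrow> complex) \<Rightarrow> complex \<Rightarrow> complex \<Rightarrow> complex" where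
  "disc_pullback_kernel \<phi> z w =
     deriv \<phi> z * cnj (deriv \<phi> w) / (of_real pi * (1 - \<phi> z * cnj (\<phi> w))\<^sup>2)"

lemma one_minus_cnj_mult_neq_0:
  assumes "cmod a < 1" "cmod b < 1"
  shows "1 - cnj a * b \<noteq> 0"
proof
  assume "1 - cnj a * b = 0"
  then have "cmod (cnj a * b) = 1" by (metis eq_iff_diff_eq_0 norm_one)
  moreover have "cmod a * cmod b < 1 * 1" using assms by (intro mult_strict_mono') auto
  ultimately show False by (simp add: norm_mult)
qed

text \<open>For fixed \<open>w\<close>, composing \<phi> with the disc automorphism that takes
  \<open>\<phi> w\<close> to 0 gives a map \<open>\<phi>w\<close> centred at \<open>w\<close>. The
  formula then equals \<open>cnj (\<phi>w' w) * \<phi>w' z / \<pi>\<close>, with primes for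
  derivatives, which the centred integral shows to be reproducing.\<close>

lemma is_reproducing_kernel_disc_pullback:
  assumes \<Omega>: "open \<Omega>" and \<phi>: "\<phi> holomorphic_on \<Omega>" "inj_on \<phi> \<Omega>" "\<phi> ` \<Omega> = ball 0 1"
  shows "is_reproducing_kernel \<Omega> (disc_pullback_kernel \<phi>)"
  unfolding is_reproducing_kernel_def
proof (intro ballI)
  fix w assume w: "w \<in> \<Omega>"
  define a where "a = \<phi> w"
  have b: "cmod (\<phi> z) < 1" if "z \<in> \<Omega>" for z using \<phi>(3) that by force
  then have a: "cmod a < 1" using w by (simp add: a_def)
  define \<phi>w where "\<phi>w = Moebius_function 0 a \<circ> \<phi>"
  note M = Moebius_bij_disc[OF a]
  have nz: "1 - cnj a * \<phi> z \<noteq> 0" if "z \<in> \<Omega>" for z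
    using one_minus_cnj_mult_neq_0[OF a b[OF that]] .
  have \<phi>w: "\<phi>w holomorphic_on \<Omega>" "inj_on \<phi>w \<Omega>" "\<phi>w ` \<Omega> = ball 0 1" "\<phi>w w = 0"
    unfolding \<phi>w_def
    subgoal using \<phi>(3) by (intro holomorphic_on_compose_gen[OF \<phi>(1) Moebius_function_holomorphic[OF a]]) auto
    subgoal using \<phi> M by (intro comp_inj_on) auto
    subgoal using \<phi>(3) M(1) by (simp only: image_comp[symmetric])
    subgoal by (simp add: a_def Moebius_function_eq_zero)
    done
  have der: "deriv \<phi>w z = (1 - cnj a * a) / (1 - cnj a * \<phi> z)\<^sup>2 * deriv \<phi> z" if "z \<in> \<Omega>" for z
    unfolding \<phi>w_def
    by (rule DERIV_imp_deriv, rule DERIV_chain[OF Moebius_has_field_derivative[OF nz[OF that]] holomorphic_derivI[OF \<phi>(1) \<Omega> that]])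
  have raa: "cnj (1 - cnj a * a) = 1 - cnj a * a" by (simp add: mult.commute)
  have derw: "deriv \<phi>w w = deriv \<phi> w / (1 - cnj a * a)"
    using der[OF w] nz[OF w] by (simp add: a_def power2_eq_square)
  have K: "disc_pullback_kernel \<phi> z w = cnj (deriv \<phi>w w) / of_real pi * deriv \<phi>w z" if "z \<in> \<Omega>" for z
  proof -
    have "cnj (deriv \<phi>w w) = cnj (deriv \<phi> w) / (1 - cnj a * a)"
      unfolding derw complex_cnj_divide raa ..
    moreover have "p * q / (of_real pi * u\<^sup>2) = q / c / of_real pi * (c / u\<^sup>2 * p)"
      if "c \<noteq> 0" for p q u c :: complex
      using that by simp
    moreover have "1 - cnj a * a \<noteq> 0" using nz[OF w] by (simp add: a_def)
    ultimately show ?thesis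
      unfolding der[OF that] disc_pullback_kernel_def a_def[symmetric] mult.commute[of "\<phi> z" "cnj a"]
      by metis
  qed
  have "deriv \<phi>w w \<noteq> 0"
    using holomorphic_injective_imp_regular[OF \<phi>w(1) \<Omega> \<phi>w(2) w] .
  have mem: "(\<lambda>z. cnj (deriv \<phi>w w) / of_real pi * deriv \<phi>w z) \<in> bergman_space \<Omega>"
    using \<phi>w \<Omega> by (intro bergman_space_scale deriv_in_bergman_space) auto
  show "(\<lambda>z. disc_pullback_kernel \<phi> z w) \<in> bergman_space \<Omega> \<and>
      (\<forall>f\<in>bergman_space \<Omega>. f w = (LINT z:\<Omega>|lborel. f z * cnj (disc_pullback_kernel \<phi> z w)))"
  proof (intro conjI ballI)
    have "(\<lambda>z. disc_pullback_kernel \<phi> z w) holomorphic_on \<Omega>"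
      by (rule holomorphic_transform[OF bergman_spaceD(1)[OF mem]]) (simp add: K)
    moreover have "set_integrable lborel \<Omega> (\<lambda>z. (cmod (disc_pullback_kernel \<phi> z w))\<^sup>2)"
      by (subst set_integrable_cong[OF refl refl]) (use bergman_spaceD(2)[OF mem] K in auto)
    ultimately show "(\<lambda>z. disc_pullback_kernel \<phi> z w) \<in> bergman_space \<Omega>"
      by (simp add: bergman_space_def)
    fix f assume f: "f \<in> bergman_space \<Omega>"
    have "(LINT z:\<Omega>|lborel. f z * cnj (disc_pullback_kernel \<phi> z w)) =
        (LINT z:\<Omega>|lborel. deriv \<phi>w w / of_real pi * (f z * cnj (deriv \<phi>w z)))"
      using \<Omega> by (intro set_lebesgue_integral_cong) (auto simp: K)
    also have "\<dots> = deriv \<phi>w w / of_real pi * (of_real pi * f w / deriv \<phi>w w)"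
      unfolding set_integral_mult_right bergman_integral_centered[OF \<Omega> \<phi>w(1-3) w \<phi>w(4) f] ..
    also have "\<dots> = f w" using \<open>deriv \<phi>w w \<noteq> 0\<close> by simp
    finally show "f w = (LINT z:\<Omega>|lborel. f z * cnj (disc_pullback_kernel \<phi> z w))" ..
  qed
qed

text \<open>The explicit kernel witnesses existence, so the chosen kernel is reproducing; uniqueness
  identifies the two.\<close>

lemma bergman_kernel_disc_pullback:
  assumes "open \<Omega>" "\<phi> holomorphic_on \<Omega>" "inj_on \<phi> \<Omega>" "\<phi> ` \<Omega> = ball 0 1"
  shows "is_reproducing_kernel \<Omega> (bergman_kernel \<Omega>)"
    and "z \<in> \<Omega> \<Longrightarrow> w \<in> \<Omega> \<Longrightarrow> bergman_kernel \<Omega> z w = disc_pullback_kernel \<phi> z w"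
proof -
  note K = is_reproducing_kernel_disc_pullback[OF assms]
  show 1: "is_reproducing_kernel \<Omega> (bergman_kernel \<Omega>)"
    unfolding bergman_kernel_def using someI[of "is_reproducing_kernel \<Omega>", OF K] .
  show "z \<in> \<Omega> \<Longrightarrow> w \<in> \<Omega> \<Longrightarrow> bergman_kernel \<Omega> z w = disc_pullback_kernel \<phi> z w"
    by (rule is_reproducing_kernel_unique[OF 1 K])
qed

section \<open>Kernels of nested domains\<close>

lemma reproducing_kernel_mem:
  "is_reproducing_kernel \<Omega> K \<Longrightarrow> w \<in> \<Omega> \<Longrightarrow> (\<lambda>z. K z w) \<in> bergman_space \<Omega>"
  by (simp add: is_reproducing_kernel_def)

lemma reproducing_kernel_combination:
  assumes \<Omega>: "open \<Omega>" and K: "is_reproducing_kernel \<Omega> K" and zw: "z \<in> \<Omega>" "w \<in> \<Omega>"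
    and h: "h \<in> bergman_space \<Omega>"
  shows "(LINT x:\<Omega>|lborel. h x * cnj (K x z + b * K x w)) = h z + cnj b * h w"
proof -
  note i = bergman_space_mult_integrable[OF \<Omega> h reproducing_kernel_mem[OF K]]
  have "(LINT x:\<Omega>|lborel. h x * cnj (K x z + b * K x w)) =
      (LINT x:\<Omega>|lborel. h x * cnj (K x z) + cnj b * (h x * cnj (K x w)))"
    by (simp add: algebra_simps)
  also have "\<dots> = (LINT x:\<Omega>|lborel. h x * cnj (K x z)) + cnj b * (LINT x:\<Omega>|lborel. h x * cnj (K x w))"
    using i zw by (subst set_integral_add(2)) auto
  also have "\<dots> = h z + cnj b * h w"
    using K zw h by (simp add: is_reproducing_kernel_def)
  finally show ?thesis .
qed

lemma reproducing_kernel_hermitian: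
  assumes K: "is_reproducing_kernel \<Omega> K" and zw: "z \<in> \<Omega>" "w \<in> \<Omega>"
  shows "K w z = cnj (K z w)"
proof -
  have "K w z = (LINT x:\<Omega>|lborel. K x z * cnj (K x w))"
    using K zw by (simp add: is_reproducing_kernel_def)
  also have "\<dots> = cnj (LINT x:\<Omega>|lborel. K x w * cnj (K x z))"
    unfolding set_lebesgue_integral_def
    by (subst Bochner_Integration.integral_cnj[symmetric]) (simp add: mult.commute)
  also have "(LINT x:\<Omega>|lborel. K x w * cnj (K x z)) = K z w"
    using K zw by (simp add: is_reproducing_kernel_def)
  finally show ?thesis .
qed

text \<open>
  The right-hand side is an upper bound for \<open>\<parallel>(L\<^sub>z + b L\<^sub>w) - (K\<^sub>z + b K\<^sub>w)\<parallel>\<^sup>2\<close> in the Bergman space of \<open>D\<close>.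
\<close>

lemma reproducing_kernel_diff_quadratic:
  assumes op: "open D" "open \<Omega>" and sub: "D \<subseteq> \<Omega>"
    and K: "is_reproducing_kernel D K" and L: "is_reproducing_kernel \<Omega> L"
    and zw: "z \<in> D" "w \<in> D" and b: "cmod b = 1"
  shows "0 \<le> Re (K z z - L z z) + Re (K w w - L w w) + 2 * Re (b * (K z w - L z w))"
proof -
  have zw': "z \<in> \<Omega>" "w \<in> \<Omega>" using zw sub by auto
  define f where "f x = L x z + b * L x w" for x
  define g where "g x = K x z + b * K x w" for x
  have f\<Omega>: "f \<in> bergman_space \<Omega>"
    unfolding f_def[abs_def] by (intro bergman_space_add op reproducing_kernel_mem L zw')
  then have fD: "f \<in> bergman_space D" using bergman_space_subset op sub by blast
  have gD: "g \<in> bergman_space D"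
    unfolding g_def[abs_def] by (intro bergman_space_add op reproducing_kernel_mem K zw)
  note i = bergman_space_mult_integrable
  have sq: "Re (h x * cnj (h x)) = (cmod (h x))\<^sup>2" for h :: "complex \<Rightarrow> complex" and x
    by (simp flip: complex_norm_square)
  have fg: "(LINT x:D|lborel. f x * cnj (g x)) = f z + cnj b * f w"
    and gg: "(LINT x:D|lborel. g x * cnj (g x)) = g z + cnj b * g w"
    unfolding g_def by (rule reproducing_kernel_combination[OF op(1) K zw], fact fD gD[unfolded g_def[abs_def]])+
  have ff: "(LINT x:\<Omega>|lborel. f x * cnj (f x)) = f z + cnj b * f w"
    unfolding f_def by (rule reproducing_kernel_combination[OF op(2) L zw' f\<Omega>[unfolded f_def[abs_def]]])
  \<comment> \<open>Restriction to \<open>D\<close> decreases the norm of \<open>f\<close>, and on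
    \<Omega> the norm is computed by the reproducing property of \<open>L\<close>.\<close>
  have "(LINT x:D|lborel. (cmod (f x))\<^sup>2) \<le> (LINT x:\<Omega>|lborel. (cmod (f x))\<^sup>2)"
    unfolding set_lebesgue_integral_def
    using bergman_spaceD(2)[OF fD] bergman_spaceD(2)[OF f\<Omega>] sub
    by (intro integral_mono) (auto simp: set_integrable_def indicator_def)
  also have "\<dots> = Re (f z + cnj b * f w)"
    using set_integral_Re(2)[OF i[OF op(2) f\<Omega> f\<Omega>]] unfolding sq ff .
  finally have le: "(LINT x:D|lborel. (cmod (f x))\<^sup>2) \<le> Re (f z + cnj b * f w)" .
  have "0 \<le> (LINT x:D|lborel. (cmod (f x - g x))\<^sup>2)"
    unfolding set_lebesgue_integral_def by (intro integral_nonneg_AE) auto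
  also have "\<dots> = (LINT x:D|lborel. ((cmod (f x))\<^sup>2 + (cmod (g x))\<^sup>2) - 2 * Re (f x * cnj (g x)))"
  proof (intro set_lebesgue_integral_cong allI impI)
    fix x
    show "(cmod (f x - g x))\<^sup>2 = ((cmod (f x))\<^sup>2 + (cmod (g x))\<^sup>2) - 2 * Re (f x * cnj (g x))"
      unfolding cmod_power2 by (simp add: power2_eq_square algebra_simps)
  qed (use op in auto)
  also have "\<dots> = ((LINT x:D|lborel. (cmod (f x))\<^sup>2) + (LINT x:D|lborel. (cmod (g x))\<^sup>2))
      - 2 * (LINT x:D|lborel. Re (f x * cnj (g x)))"
  proof -
    have 1: "set_integrable lborel D (\<lambda>x. (cmod (f x))\<^sup>2 + (cmod (g x))\<^sup>2)"
      by (intro set_integral_add(1) bergman_spaceD(2) fD gD)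
    have 2: "set_integrable lborel D (\<lambda>x. 2 * Re (f x * cnj (g x)))"
      by (intro set_integrable_mult_right set_integral_Re(1) i op fD gD)
    show ?thesis
      unfolding set_integral_diff(2)[OF 1 2] set_integral_add(2)[OF bergman_spaceD(2)[OF fD] bergman_spaceD(2)[OF gD]]
        set_integral_mult_right ..
  qed
  also have "(LINT x:D|lborel. Re (f x * cnj (g x))) = Re (f z + cnj b * f w)"
    using set_integral_Re(2)[OF i[OF op(1) fD gD]] unfolding fg .
  also have "(LINT x:D|lborel. (cmod (g x))\<^sup>2) = Re (g z + cnj b * g w)"
    using set_integral_Re(2)[OF i[OF op(1) gD gD]] unfolding sq gg .
  \<comment> \<open>The cross term contributes the expression in \<open>f\<close> twice with a minus
    sign, the norm of \<open>f\<close> at most once with a plus sign; one negative copy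
    remains.\<close>
  finally have main: "0 \<le> Re (g z + cnj b * g w) - Re (f z + cnj b * f w)"
    using le by linarith
  have "cnj b * b = 1"
    using complex_norm_square[of b] b by (simp add: mult.commute)
  then have bb: "cnj b * (b * x) = x" for x
    by (simp add: mult.assoc[symmetric])
  \<comment> \<open>|b| = 1 removes the factor from the second diagonal term, and Hermitian symmetry
    merges the two cross terms.\<close>
  have expand: "Re ((M z z + b * M z w) + cnj b * (M w z + b * M w w)) = Re (M z z) + Re (M w w) + 2 * Re (b * M z w)"
    if "M w z = cnj (M z w)" for M :: "complex \<Rightarrow> complex \<Rightarrow> complex"
    unfolding distrib_left bb that by (simp add: algebra_simps)
  show ?thesis
    using main unfolding f_def g_def expand[of K, OF reproducing_kernel_hermitian[OF K zw]]
      expand[of L, OF reproducing_kernel_hermitian[OF L zw']]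
    by (simp add: algebra_simps)
qed

text \<open>The unimodular \<open>b\<close> is chosen so that \<open>b * (K z w - L z w)\<close> is
  minus its modulus; the quadratic inequality then bounds this modulus by the diagonal
  differences.\<close>

lemma reproducing_kernel_diff_bound:
  assumes op: "open D" "open \<Omega>" and sub: "D \<subseteq> \<Omega>"
    and K: "is_reproducing_kernel D K" and L: "is_reproducing_kernel \<Omega> L"
    and zw: "z \<in> D" "w \<in> D"
  shows "cmod (K z w - L z w) \<le> (Re (K z z - L z z) + Re (K w w - L w w)) / 2"
proof -
  let ?H = "K z w - L z w"
  \<comment> \<open>Since \<open>sgn 0 = 0\<close>, a vanishing difference needs its own unimodular
    value.\<close>
  define b where "b = (if ?H = 0 then 1 else - cnj (sgn ?H))"
  have b: "cmod b = 1" by (simp add: b_def norm_sgn)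
  have "b * ?H = - of_real (cmod ?H)"
  proof (cases "?H = 0")
    case False
    have "b * ?H = - cnj (sgn ?H) * (of_real (cmod ?H) * sgn ?H)"
      using False by (simp add: b_def sgn_eq)
    also have "\<dots> = - (of_real (cmod ?H) * (sgn ?H * cnj (sgn ?H)))"
      by (simp only: mult_minus_left mult_minus_right mult_ac)
    also have "sgn ?H * cnj (sgn ?H) = 1"
      using False complex_norm_square[of "sgn ?H"] by (simp add: norm_sgn)
    finally show ?thesis by simp
  qed simp
  then have "Re (b * ?H) = - cmod ?H" by (simp only: uminus_complex.sel Re_complex_of_real)
  then show ?thesis
    using reproducing_kernel_diff_quadratic[OF op sub K L zw b] by simp
qed

section \<open>Dependence on the domain\<close>

lemma Riemann_map_at:
  assumes \<Omega>: "open \<Omega>" "simply_connected \<Omega>" "bounded \<Omega>" and z: "z \<in> \<Omega>"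
  obtains \<phi> \<psi> where "\<phi> holomorphic_on \<Omega>" "inj_on \<phi> \<Omega>" "\<phi> ` \<Omega> = ball 0 1" "\<phi> z = 0"
    "\<psi> holomorphic_on ball 0 1" "inj_on \<psi> (ball 0 1)" "\<psi> ` ball 0 1 = \<Omega>"
    "\<And>x. x \<in> \<Omega> \<Longrightarrow> \<psi> (\<phi> x) = x" "\<And>\<zeta>. \<zeta> \<in> ball 0 1 \<Longrightarrow> \<phi> (\<psi> \<zeta>) = \<zeta>"
proof -
  have "\<Omega> \<noteq> {}" "\<Omega> \<noteq> UNIV" using z \<Omega>(3) not_bounded_UNIV by auto
  then obtain f g where fg: "f holomorphic_on \<Omega>" "g holomorphic_on ball 0 1"
      "\<And>x. x \<in> \<Omega> \<Longrightarrow> f x \<in> ball 0 1 \<and> g (f x) = x" "\<And>\<zeta>. \<zeta> \<in> ball 0 1 \<Longrightarrow> g \<zeta> \<in> \<Omega> \<and> f (g \<zeta>) = \<zeta>"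
    using Riemann_mapping_theorem[of \<Omega>] \<Omega> by (auto simp: Ball_def)
  define a where "a = f z"
  have a: "cmod a < 1" "cmod (-a) < 1" using fg(3)[OF z] by (auto simp: a_def)
  define \<phi> where "\<phi> = Moebius_function 0 a \<circ> f"
  define \<psi> where "\<psi> = g \<circ> Moebius_function 0 (-a)"
  have Mb: "Moebius_function 0 a \<zeta> \<in> ball 0 1" "Moebius_function 0 (-a) \<zeta> \<in> ball 0 1" if "\<zeta> \<in> ball 0 1" for \<zeta>
    using Moebius_function_norm_lt_1[OF a(1)] Moebius_function_norm_lt_1[OF a(2)] that by auto
  have M: "Moebius_function 0 (-a) (Moebius_function 0 a \<zeta>) = \<zeta>" "Moebius_function 0 a (Moebius_function 0 (-a) \<zeta>) = \<zeta>"
    if "\<zeta> \<in> ball 0 1" for \<zeta>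
    using Moebius_function_compose[of "-a" a \<zeta>] Moebius_function_compose[of a "-a" \<zeta>] that a by auto
  have 1: "\<phi> x \<in> ball 0 1" "\<psi> (\<phi> x) = x" if "x \<in> \<Omega>" for x
    using fg(3)[OF that] Mb M by (auto simp: \<phi>_def \<psi>_def simp del: mem_ball_0)
  have 2: "\<psi> \<zeta> \<in> \<Omega>" "\<phi> (\<psi> \<zeta>) = \<zeta>" if "\<zeta> \<in> ball 0 1" for \<zeta>
    using fg(4) Mb[OF that] M[OF that] by (auto simp: \<phi>_def \<psi>_def simp del: mem_ball_0)
  show thesis
  proof (rule that)
    show "\<phi> holomorphic_on \<Omega>"
      unfolding \<phi>_def using fg(3)
      by (intro holomorphic_on_compose_gen[OF fg(1) Moebius_function_holomorphic[OF a(1)]]) blast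
    show "\<psi> holomorphic_on ball 0 1"
      unfolding \<psi>_def using Mb(2)
      by (intro holomorphic_on_compose_gen[OF Moebius_function_holomorphic[OF a(2)] fg(2)]) blast
    show "inj_on \<phi> \<Omega>" by (rule inj_on_inverseI) (rule 1(2))
    show "inj_on \<psi> (ball 0 1)" by (rule inj_on_inverseI) (rule 2(2))
    show "\<phi> ` \<Omega> = ball 0 1"
    proof
      show "\<phi> ` \<Omega> \<subseteq> ball 0 1" using 1(1) by blast
      show "ball 0 1 \<subseteq> \<phi> ` \<Omega>" using 2 by (intro subsetI) (metis image_eqI)
    qed
    show "\<psi> ` ball 0 1 = \<Omega>"
    proof
      show "\<psi> ` ball 0 1 \<subseteq> \<Omega>" using 2(1) by blast
      show "\<Omega> \<subseteq> \<psi> ` ball 0 1" using 1 by (intro subsetI) (metis image_eqI)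
    qed
    show "\<phi> z = 0" by (simp add: \<phi>_def a_def Moebius_function_eq_zero)
  qed (rule 1(2) 2(2), assumption)+
qed

text \<open>Every frontier point is an omitted value at distance at least \<open>d\<close> from
  \<open>\<psi> 0\<close>, so the estimate passes to the infimum. Boundedness makes the frontier
  nonempty, so that \<open>infdist\<close> is not its default value 0.\<close>

lemma boundary_dist_univalent_ge:
  assumes \<psi>: "\<psi> holomorphic_on ball 0 1" "inj_on \<psi> (ball 0 1)"
    and bd: "bounded (\<psi> ` ball 0 1)" and d: "ball (\<psi> 0) d \<subseteq> \<psi> ` ball 0 1" and \<zeta>: "\<zeta> \<in> ball 0 1"
  shows "d * (1 - cmod \<zeta>)\<^sup>2 / 4 \<le> boundary_dist (\<psi> ` ball 0 1) (\<psi> \<zeta>)"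
proof -
  let ?\<Omega> = "\<psi> ` ball 0 1"
  have op: "open ?\<Omega>" using open_mapping_thm3[OF \<psi>(1) open_ball \<psi>(2)] .
  have "?\<Omega> \<noteq> UNIV" using bd not_bounded_UNIV by metis
  then have "frontier ?\<Omega> \<noteq> {}"
    using frontier_eq_empty[of ?\<Omega>] by auto
  moreover have "d * (1 - cmod \<zeta>)\<^sup>2 / 4 \<le> dist (\<psi> \<zeta>) p" if "p \<in> frontier ?\<Omega>" for p
  proof -
    have p: "p \<notin> ?\<Omega>" using that op frontier_disjoint_eq[of ?\<Omega>] by auto
    then have "p \<notin> ball (\<psi> 0) d" using d by blast
    then have "d * (1 - cmod \<zeta>)\<^sup>2 / 4 \<le> dist (\<psi> 0) p * (1 - cmod \<zeta>)\<^sup>2 / 4"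
      by (intro divide_right_mono mult_right_mono) auto
    also have "\<dots> \<le> dist (\<psi> \<zeta>) p"
      by (rule univalent_dist_omitted_value[OF \<psi> p \<zeta>])
    finally show ?thesis .
  qed
  ultimately show ?thesis
    unfolding boundary_dist_def by (subst infdist_notempty) (auto intro: cINF_greatest simp del: divide_le_eq_numeral1)
qed

section \<open>Kernels of the sublevel sets of a Riemann map\<close>

lemma inverse_square_diff_bound:
  fixes q \<rho> m :: real
  assumes "0 < m" "m \<le> \<rho>\<^sup>2 - q\<^sup>2" "0 < \<rho>" "\<rho> < 1"
  shows "\<rho>\<^sup>2 / (\<rho>\<^sup>2 - q\<^sup>2)\<^sup>2 - 1 / (1 - q\<^sup>2)\<^sup>2 \<le> 4 / m ^ 4 * (1 - \<rho>)"
proof -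
  \<comment> \<open>With \<open>q\<close> the modulus of the Riemann map,
    \<open>\<rho>\<^sup>2 / A\<^sup>2\<close> and \<open>1 / B\<^sup>2\<close> are, up to a common
    factor, the diagonal kernels of the sublevel set and of the domain. As
    \<open>B - A = 1 - \<rho>\<^sup>2\<close>, their difference is linear in 1 - \<rho>.\<close>
  define A where "A = \<rho>\<^sup>2 - q\<^sup>2"
  define B where "B = 1 - q\<^sup>2"
  have \<rho>2: "\<rho>\<^sup>2 \<le> 1" using assms by (simp add: power_le_one)
  have AB: "m \<le> A" "A \<le> B" "B \<le> 1" "0 < A" "0 < B"
    using assms \<rho>2 by (auto simp: A_def B_def)
  have diff: "B - A \<le> 2 * (1 - \<rho>)"
  proof -
    have "B - A = (1 - \<rho>) * (1 + \<rho>)" by (simp add: A_def B_def power2_eq_square algebra_simps)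
    also have "\<dots> \<le> (1 - \<rho>) * 2" using assms by (intro mult_left_mono) auto
    finally show ?thesis by simp
  qed
  have "\<rho>\<^sup>2 / A\<^sup>2 - 1 / B\<^sup>2 \<le> 1 / A\<^sup>2 - 1 / B\<^sup>2"
    using \<rho>2 by (intro diff_right_mono divide_right_mono) auto
  also have "\<dots> = (B - A) * (B + A) / (A\<^sup>2 * B\<^sup>2)"
    using AB by (simp add: field_simps power2_eq_square)
  also have "\<dots> \<le> (2 * (1 - \<rho>)) * 2 / (A\<^sup>2 * B\<^sup>2)"
    using AB diff assms by (intro divide_right_mono mult_mono) auto
  also have "\<dots> \<le> (2 * (1 - \<rho>)) * 2 / m ^ 4"
  proof (rule divide_left_mono)
    have "m ^ 4 = m\<^sup>2 * m\<^sup>2" by (simp add: power2_eq_square power4_eq_xxxx)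
    also have "\<dots> \<le> A\<^sup>2 * B\<^sup>2" using AB assms by (intro mult_mono power_mono) auto
    finally show "m ^ 4 \<le> A\<^sup>2 * B\<^sup>2" .
  qed (use AB assms in auto)
  finally show ?thesis by (simp add: A_def B_def)
qed

text \<open>Cauchy's estimate on the circle of radius \<open>d / 2\<close>, which stays inside the
  open ball.\<close>

lemma deriv_bound_into_disc:
  assumes \<phi>: "\<phi> holomorphic_on ball x d" "\<And>y. y \<in> ball x d \<Longrightarrow> cmod (\<phi> y) < 1" and d: "d > 0"
  shows "cmod (deriv \<phi> x) \<le> 2 / d"
proof -
  have "cmod ((deriv ^^ 1) \<phi> x) \<le> fact 1 * 1 / (d / 2) ^ 1"
  proof (rule Cauchy_inequality)
    show "\<phi> holomorphic_on ball x (d / 2)"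
      using d by (intro holomorphic_on_subset[OF \<phi>(1)]) auto
    have "cball x (d / 2) \<subseteq> ball x d" using d by auto
    then show "continuous_on (cball x (d / 2)) \<phi>"
      using holomorphic_on_imp_continuous_on[OF \<phi>(1)] continuous_on_subset by blast
    show "cmod (\<phi> y) \<le> 1" if "cmod (x - y) = d / 2" for y
      using \<phi>(2)[of y] d that by (auto simp: dist_norm)
  qed (use d in auto)
  then show ?thesis by simp
qed

lemma disc_pullback_kernel_diag:
  "Re (disc_pullback_kernel \<phi> x x) = (cmod (deriv \<phi> x))\<^sup>2 / (pi * (1 - (cmod (\<phi> x))\<^sup>2)\<^sup>2)"
proof -
  have "disc_pullback_kernel \<phi> x x = of_real ((cmod (deriv \<phi> x))\<^sup>2 / (pi * (1 - (cmod (\<phi> x))\<^sup>2)\<^sup>2))"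
    unfolding disc_pullback_kernel_def complex_norm_square[symmetric]
    by simp
  then show ?thesis by (simp only: Re_complex_of_real)
qed

text \<open>\<open>\<phi> / \<rho>\<close> maps the sublevel set conformally onto the disc, so both
  diagonal kernels are explicit. Their common factor |\<phi>'|^2/\<pi> is at most 4/(\<pi> d^2) by
  Cauchy's estimate.\<close>

lemma bergman_kernel_sublevel:
  assumes \<Omega>: "open \<Omega>" and \<phi>: "\<phi> holomorphic_on \<Omega>" "inj_on \<phi> \<Omega>" "\<phi> ` \<Omega> = ball 0 1"
    and \<rho>: "0 < \<rho>" "\<rho> < 1" and D: "D = {x \<in> \<Omega>. cmod (\<phi> x) < \<rho>}"
  shows "open D" "is_reproducing_kernel D (bergman_kernel D)"
    and "x \<in> D \<Longrightarrow> ball x d \<subseteq> \<Omega> \<Longrightarrow> 0 < d \<Longrightarrow> 0 < m \<Longrightarrow> m \<le> \<rho>\<^sup>2 - (cmod (\<phi> x))\<^sup>2 \<Longrightarrow>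
      Re (bergman_kernel D x x) \<le> Re (bergman_kernel \<Omega> x x) + 16 / (pi * d\<^sup>2 * m ^ 4) * (1 - \<rho>)"
proof -
  have D': "D = \<Omega> \<inter> \<phi> -` ball 0 \<rho>" using D by auto
  show op: "open D"
    unfolding D' using holomorphic_on_imp_continuous_on[OF \<phi>(1)] \<Omega>
    by (intro continuous_open_preimage) auto
  have sub: "D \<subseteq> \<Omega>" using D by auto
  define \<phi>' where "\<phi>' x = \<phi> x / of_real \<rho>" for x
  have \<phi>'1: "\<phi>' holomorphic_on D"
    unfolding \<phi>'_def[abs_def] using \<phi>(1) sub \<rho> by (auto intro!: holomorphic_intros intro: holomorphic_on_subset)
  have \<phi>'2: "inj_on \<phi>' D"
    using \<phi>(2) sub \<rho> by (auto simp: inj_on_def \<phi>'_def)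
  have \<phi>'3: "\<phi>' ` D = ball 0 1"
  proof
    show "\<phi>' ` D \<subseteq> ball 0 1" using \<rho> D by (auto simp: \<phi>'_def norm_divide)
    show "ball 0 1 \<subseteq> \<phi>' ` D"
    proof
      fix \<zeta> :: complex assume \<zeta>: "\<zeta> \<in> ball 0 1"
      have "cmod (of_real \<rho> * \<zeta>) < \<rho>" using \<zeta> \<rho> by (simp add: norm_mult)
      moreover from this have "of_real \<rho> * \<zeta> \<in> \<phi> ` \<Omega>" using \<rho> unfolding \<phi>(3) by simp
      ultimately obtain x where "x \<in> D" "\<phi> x = of_real \<rho> * \<zeta>" using D by auto
      then show "\<zeta> \<in> \<phi>' ` D" using \<rho> by (auto simp: \<phi>'_def image_iff intro!: bexI[of _ x])
    qed
  qed
  note KD = bergman_kernel_disc_pullback[OF op \<phi>'1 \<phi>'2 \<phi>'3]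
  note K\<Omega> = bergman_kernel_disc_pullback[OF \<Omega> \<phi>]
  show "is_reproducing_kernel D (bergman_kernel D)" by (rule KD(1))
  assume x: "x \<in> D" and ball: "ball x d \<subseteq> \<Omega>" and d: "0 < d" and m: "0 < m" "m \<le> \<rho>\<^sup>2 - (cmod (\<phi> x))\<^sup>2"
  have x\<Omega>: "x \<in> \<Omega>" using x sub by auto
  define q where "q = cmod (\<phi> x)"
  define P where "P = (cmod (deriv \<phi> x))\<^sup>2 / pi"
  have "(\<phi> has_field_derivative deriv \<phi> x) (at x)"
    by (rule holomorphic_derivI[OF \<phi>(1) \<Omega> x\<Omega>])
  then have "(\<phi>' has_field_derivative deriv \<phi> x / of_real \<rho>) (at x)"
    unfolding \<phi>'_def[abs_def] by (rule DERIV_cdivide)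
  then have "deriv \<phi>' x = deriv \<phi> x / of_real \<rho>" by (rule DERIV_imp_deriv)
  then have n: "cmod (deriv \<phi>' x) = cmod (deriv \<phi> x) / \<rho>" "cmod (\<phi>' x) = q / \<rho>"
    using \<rho> by (simp_all add: norm_divide \<phi>'_def q_def)
  have A: "\<rho>\<^sup>2 - q\<^sup>2 > 0" using m by (simp add: q_def)
  have e: "(p / \<rho>)\<^sup>2 / (pi * (1 - (q / \<rho>)\<^sup>2)\<^sup>2) = p\<^sup>2 / pi * (\<rho>\<^sup>2 / (\<rho>\<^sup>2 - q\<^sup>2)\<^sup>2)" for p
  proof -
    have "1 - (q / \<rho>)\<^sup>2 = (\<rho>\<^sup>2 - q\<^sup>2) / \<rho>\<^sup>2" using \<rho> by (simp add: field_simps power2_eq_square)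
    then have "(1 - (q / \<rho>)\<^sup>2)\<^sup>2 = (\<rho>\<^sup>2 - q\<^sup>2)\<^sup>2 / (\<rho>\<^sup>2 * \<rho>\<^sup>2)"
      by (simp add: power_divide power2_eq_square[of "\<rho>\<^sup>2"])
    moreover have "P / R / (pi * (X / (R * R))) = P / pi * (R / X)" if "R > 0" "X > 0" for P R X :: real
      using that by (simp add: field_simps)
    ultimately have "p\<^sup>2 / \<rho>\<^sup>2 / (pi * (1 - (q / \<rho>)\<^sup>2)\<^sup>2) = p\<^sup>2 / pi * (\<rho>\<^sup>2 / (\<rho>\<^sup>2 - q\<^sup>2)\<^sup>2)"
      using \<rho> A by (metis zero_less_power)
    then show ?thesis by (simp only: power_divide[of p])
  qed
  have D1: "Re (bergman_kernel D x x) = P * (\<rho>\<^sup>2 / (\<rho>\<^sup>2 - q\<^sup>2)\<^sup>2)"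
    unfolding KD(2)[OF x x] disc_pullback_kernel_diag n P_def e ..
  have D2: "Re (bergman_kernel \<Omega> x x) = P * (1 / (1 - q\<^sup>2)\<^sup>2)"
    unfolding K\<Omega>(2)[OF x\<Omega> x\<Omega>] disc_pullback_kernel_diag P_def q_def by simp
  have "\<phi> holomorphic_on ball x d" using \<phi>(1) ball holomorphic_on_subset by blast
  moreover have "cmod (\<phi> y) < 1" if "y \<in> ball x d" for y
    using that ball \<phi>(3) by force
  ultimately have "cmod (deriv \<phi> x) \<le> 2 / d" by (rule deriv_bound_into_disc) (simp_all add: d)
  then have "(cmod (deriv \<phi> x))\<^sup>2 \<le> (2 / d)\<^sup>2" by (intro power_mono) auto
  then have P: "P \<le> 4 / (pi * d\<^sup>2)" by (simp add: P_def power_divide divide_right_mono field_simps)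
  have "Re (bergman_kernel D x x) - Re (bergman_kernel \<Omega> x x) = P * (\<rho>\<^sup>2 / (\<rho>\<^sup>2 - q\<^sup>2)\<^sup>2 - 1 / (1 - q\<^sup>2)\<^sup>2)"
    unfolding D1 D2 by (simp only: right_diff_distrib)
  also have "\<dots> \<le> P * (4 / m ^ 4 * (1 - \<rho>))"
    using inverse_square_diff_bound[OF m \<rho>] by (intro mult_left_mono) (auto simp: P_def q_def)
  also have "\<dots> \<le> 4 / (pi * d\<^sup>2) * (4 / m ^ 4 * (1 - \<rho>))"
    using P \<rho> m by (intro mult_right_mono) auto
  also have "\<dots> = 16 / (pi * d\<^sup>2 * m ^ 4) * (1 - \<rho>)" by simp
  finally show "Re (bergman_kernel D x x) \<le> Re (bergman_kernel \<Omega> x x) + 16 / (pi * d\<^sup>2 * m ^ 4) * (1 - \<rho>)"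
    by linarith
qed

text \<open>
  The bound \<open>r\<close> on all maps into the disc that vanish at \<open>z\<close> keeps \<open>w\<close> away from the boundary
  of the disc uniformly in the parameter; in the theorem it comes from Schwarz' lemma on a fixed
  disc-like neighbourhood of \<open>z\<close> and \<open>w\<close>.
\<close>

lemma bergman_kernel_inner_domain:
  assumes \<Omega>: "open \<Omega>" "simply_connected \<Omega>" "bounded \<Omega>"
    and sub: "{x \<in> \<Omega>. boundary_dist \<Omega> x > B} \<subseteq> \<Omega>'"
    and d: "0 < d" "ball z d \<subseteq> \<Omega>" "ball w d \<subseteq> \<Omega>"
    and r: "\<And>\<phi>. \<phi> holomorphic_on \<Omega> \<Longrightarrow> \<phi> ` \<Omega> \<subseteq> ball 0 1 \<Longrightarrow> \<phi> z = 0 \<Longrightarrow> cmod (\<phi> w) \<le> r" "0 \<le> r" "r < 1"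
    and B: "0 < B" and \<tau>: "\<tau> = 2 * sqrt (B / d)" "\<tau> \<le> (1 - r) / 2"
    and C: "C = 16 / (pi * d\<^sup>2 * (((1 + r) / 2)\<^sup>2 - r\<^sup>2) ^ 4)"
  obtains D where "open D" "D \<subseteq> \<Omega>" "D \<subseteq> \<Omega>'" "z \<in> D" "w \<in> D"
    "is_reproducing_kernel \<Omega> (bergman_kernel \<Omega>)" "is_reproducing_kernel D (bergman_kernel D)"
    "Re (bergman_kernel D z z) \<le> Re (bergman_kernel \<Omega> z z) + C * \<tau>"
    "Re (bergman_kernel D w w) \<le> Re (bergman_kernel \<Omega> w w) + C * \<tau>"
proof -
  have zw: "z \<in> \<Omega>" "w \<in> \<Omega>" using d by auto
  obtain \<phi> \<psi> where \<phi>: "\<phi> holomorphic_on \<Omega>" "inj_on \<phi> \<Omega>" "\<phi> ` \<Omega> = ball 0 1" "\<phi> z = 0"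
    and \<psi>: "\<psi> holomorphic_on ball 0 1" "inj_on \<psi> (ball 0 1)" "\<psi> ` ball 0 1 = \<Omega>"
    and inv: "\<And>x. x \<in> \<Omega> \<Longrightarrow> \<psi> (\<phi> x) = x" "\<And>\<zeta>. \<zeta> \<in> ball 0 1 \<Longrightarrow> \<phi> (\<psi> \<zeta>) = \<zeta>"
    using Riemann_map_at[OF \<Omega> zw(1)] by metis
  \<comment> \<open>\<tau> solves \<open>d * \<tau>\<^sup>2 / 4 = B\<close>: where
    \<open>|\<phi>| < 1 - \<tau>\<close>, the Koebe-type bound gives boundary distance greater than
    \<open>B\<close>, which puts the sublevel set into \<open>\<Omega>'\<close>.\<close>
  define \<rho> where "\<rho> = 1 - \<tau>"
  have "0 < \<tau>" using B d by (simp add: \<tau>(1))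
  have \<rho>r: "(1 + r) / 2 \<le> \<rho>" using \<tau>(2) by (simp add: \<rho>_def field_simps)
  have \<rho>: "0 < \<rho>" "\<rho> < 1" using \<rho>r r(2) \<open>0 < \<tau>\<close> by (auto simp: \<rho>_def)
  \<comment> \<open>Since \<open>\<rho> \<ge> (1 + r) / 2\<close>, this bounds
    \<open>\<rho>\<^sup>2 - q\<^sup>2\<close> from below both for \<open>q = 0\<close> at
    \<open>z\<close> and for \<open>q = |\<phi> w| \<le> r\<close>.\<close>
  define m where "m = ((1 + r) / 2)\<^sup>2 - r\<^sup>2"
  have m: "0 < m"
    unfolding m_def using r power_strict_mono[of r "(1 + r) / 2" 2] by simp
  have mle: "m \<le> \<rho>\<^sup>2 - q\<^sup>2" if "0 \<le> q" "q \<le> r" for q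
    unfolding m_def using \<rho>r r that by (intro diff_mono power_mono) auto
  define D where "D = {x \<in> \<Omega>. cmod (\<phi> x) < \<rho>}"
  have \<phi>w: "cmod (\<phi> w) \<le> r" using \<phi> by (intro r(1)) auto
  note KD = bergman_kernel_sublevel[OF \<Omega>(1) \<phi>(1-3) \<rho> D_def]
  have zD: "z \<in> D" using zw \<rho> \<phi>(4) by (simp add: D_def)
  have wD: "w \<in> D" using zw \<rho>r \<phi>w r by (simp add: D_def)
  have \<tau>C: "16 / (pi * d\<^sup>2 * m ^ 4) * (1 - \<rho>) = C * \<tau>"
    by (simp add: C m_def \<rho>_def)
  show thesis
  proof (rule that[of D])
    show "D \<subseteq> \<Omega>'"
    proof
      fix x assume x: "x \<in> D"
      then have x\<Omega>: "x \<in> \<Omega>" "cmod (\<phi> x) < \<rho>" by (auto simp: D_def)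
      have \<psi>0: "\<psi> 0 = z" using inv(1)[OF zw(1)] \<phi>(4) by simp
      have "d * (1 - cmod (\<phi> x))\<^sup>2 / 4 \<le> boundary_dist (\<psi> ` ball 0 1) (\<psi> (\<phi> x))"
        using x\<Omega> \<rho> \<psi> \<Omega>(3) d(2) by (intro boundary_dist_univalent_ge) (auto simp: \<psi>0)
      then have 1: "d * (1 - cmod (\<phi> x))\<^sup>2 / 4 \<le> boundary_dist \<Omega> x"
        using inv(1)[OF x\<Omega>(1)] \<psi>(3) by simp
      have "\<tau>\<^sup>2 < (1 - cmod (\<phi> x))\<^sup>2"
        using x\<Omega>(2) \<open>0 < \<tau>\<close> by (intro power_strict_mono) (auto simp: \<rho>_def)
      moreover have "\<tau>\<^sup>2 = 4 * B / d"
        using B d by (simp add: \<tau>(1) power_mult_distrib)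
      ultimately have "B < d * (1 - cmod (\<phi> x))\<^sup>2 / 4"
        using d by (simp add: field_simps)
      then show "x \<in> \<Omega>'" using 1 sub x\<Omega> by auto
    qed
    show "is_reproducing_kernel \<Omega> (bergman_kernel \<Omega>)"
      by (rule bergman_kernel_disc_pullback(1)[OF \<Omega>(1) \<phi>(1-3)])
    show "Re (bergman_kernel D z z) \<le> Re (bergman_kernel \<Omega> z z) + C * \<tau>"
      using KD(3)[OF zD d(2,1) m mle] \<phi>(4) r(2) unfolding \<tau>C by simp
    show "Re (bergman_kernel D w w) \<le> Re (bergman_kernel \<Omega> w w) + C * \<tau>"
      using KD(3)[OF wD d(3,1) m mle] \<phi>w unfolding \<tau>C by simp
    show "D \<subseteq> \<Omega>" by (auto simp: D_def)
  qed (fact KD(1,2) zD wD)+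
qed

text \<open>Both kernels are compared with that of \<open>D1\<close>, a subset of both domains. This
  costs \<open>C * \<tau>\<close> for \<open>\<Omega>1\<close> and, through the second inner domain
  \<open>D2\<close>, twice as much for \<open>\<Omega>2\<close>.\<close>

lemma bergman_kernel_diff_bound:
  assumes \<Omega>1: "open \<Omega>1" "simply_connected \<Omega>1" "bounded \<Omega>1"
    and \<Omega>2: "open \<Omega>2" "simply_connected \<Omega>2" "bounded \<Omega>2"
    and sub: "{x \<in> \<Omega>1. boundary_dist \<Omega>1 x > B} \<subseteq> \<Omega>2" "{x \<in> \<Omega>2. boundary_dist \<Omega>2 x > B} \<subseteq> \<Omega>1"
    and d: "0 < d" "ball z d \<subseteq> \<Omega>1" "ball w d \<subseteq> \<Omega>1" "ball z d \<subseteq> \<Omega>2" "ball w d \<subseteq> \<Omega>2"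
    and r1: "\<And>\<phi>. \<phi> holomorphic_on \<Omega>1 \<Longrightarrow> \<phi> ` \<Omega>1 \<subseteq> ball 0 1 \<Longrightarrow> \<phi> z = 0 \<Longrightarrow> cmod (\<phi> w) \<le> r"
    and r2: "\<And>\<phi>. \<phi> holomorphic_on \<Omega>2 \<Longrightarrow> \<phi> ` \<Omega>2 \<subseteq> ball 0 1 \<Longrightarrow> \<phi> z = 0 \<Longrightarrow> cmod (\<phi> w) \<le> r"
    and r: "0 \<le> r" "r < 1"
    and B: "0 < B" and \<tau>: "\<tau> = 2 * sqrt (B / d)" "\<tau> \<le> (1 - r) / 2"
    and C: "C = 16 / (pi * d\<^sup>2 * (((1 + r) / 2)\<^sup>2 - r\<^sup>2) ^ 4)"
  shows "cmod (bergman_kernel \<Omega>1 z w - bergman_kernel \<Omega>2 z w) \<le> 3 * C * \<tau>"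
proof -
  obtain D1 where D1: "open D1" "D1 \<subseteq> \<Omega>1" "D1 \<subseteq> \<Omega>2" "z \<in> D1" "w \<in> D1"
    and K1: "is_reproducing_kernel \<Omega>1 (bergman_kernel \<Omega>1)" and KD1: "is_reproducing_kernel D1 (bergman_kernel D1)"
    and le1: "Re (bergman_kernel D1 z z) \<le> Re (bergman_kernel \<Omega>1 z z) + C * \<tau>"
      "Re (bergman_kernel D1 w w) \<le> Re (bergman_kernel \<Omega>1 w w) + C * \<tau>"
    by (rule bergman_kernel_inner_domain[OF \<Omega>1 sub(1) d(1-3) _ r B \<tau> C]; (erule (2) r1 | erule (8) that))
  obtain D2 where D2: "open D2" "D2 \<subseteq> \<Omega>2" "D2 \<subseteq> \<Omega>1" "z \<in> D2" "w \<in> D2"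
    and K2: "is_reproducing_kernel \<Omega>2 (bergman_kernel \<Omega>2)" and KD2: "is_reproducing_kernel D2 (bergman_kernel D2)"
    and le2: "Re (bergman_kernel D2 z z) \<le> Re (bergman_kernel \<Omega>2 z z) + C * \<tau>"
      "Re (bergman_kernel D2 w w) \<le> Re (bergman_kernel \<Omega>2 w w) + C * \<tau>"
    by (rule bergman_kernel_inner_domain[OF \<Omega>2 sub(2) d(1,4,5) _ r B \<tau> C]; (erule (2) r2 | erule (8) that))
  \<comment> \<open>With both points equal, the bound on the kernel difference has a nonnegative
    left side; this is monotonicity on the diagonal.\<close>
  have mono: "Re (bergman_kernel \<Omega>1 x x) \<le> Re (bergman_kernel D2 x x)" if "x \<in> D2" for x
    using order_trans[OF norm_ge_zero reproducing_kernel_diff_bound[OF D2(1) \<Omega>1(1) D2(3) KD2 K1 that that]]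
    by simp
  have "cmod (bergman_kernel D1 z w - bergman_kernel \<Omega>1 z w) \<le> C * \<tau>"
    using reproducing_kernel_diff_bound[OF D1(1) \<Omega>1(1) D1(2) KD1 K1 D1(4,5)] le1 by simp
  \<comment> \<open>On the diagonal the kernel of \<open>D1\<close> exceeds that of
    \<open>\<Omega>1\<close> by at most \<open>C * \<tau>\<close>, the latter is at most that of
    \<open>D2\<close>, and that exceeds the kernel of \<open>\<Omega>2\<close> by at most
    \<open>C * \<tau>\<close>.\<close>
  moreover have "cmod (bergman_kernel D1 z w - bergman_kernel \<Omega>2 z w) \<le> 2 * (C * \<tau>)"
    using reproducing_kernel_diff_bound[OF D1(1) \<Omega>2(1) D1(3) KD1 K2 D1(4,5)] le1 le2 mono[OF D2(4)] mono[OF D2(5)]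
    by simp
  moreover have "cmod (bergman_kernel \<Omega>1 z w - bergman_kernel \<Omega>2 z w) \<le>
      cmod (bergman_kernel D1 z w - bergman_kernel \<Omega>1 z w) + cmod (bergman_kernel D1 z w - bergman_kernel \<Omega>2 z w)"
    using norm_triangle_ineq4[of "bergman_kernel D1 z w - bergman_kernel \<Omega>2 z w" "bergman_kernel D1 z w - bergman_kernel \<Omega>1 z w"]
    by simp
  ultimately show ?thesis by simp
qed

section \<open>Constants uniform in the parameter\<close>

lemma powr_less_near_0:
  fixes a e :: real
  assumes "0 < a" "0 < e"
  obtains \<eta> where "0 < \<eta>" "\<And>x. 0 \<le> x \<Longrightarrow> x < \<eta> \<Longrightarrow> x powr a < e"
proof
  show "0 < e powr (1 / a)" using assms by simp
  show "x powr a < e" if "0 \<le> x" "x < e powr (1 / a)" for x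
    using powr_less_mono2[OF assms(1) that] assms by (simp add: powr_powr)
qed

text \<open>The estimate for two domains supplies the rate. What remains is to find \<open>d\<close>
  and \<open>r\<close> that serve all parameters near \<open>t\<^sub>0\<close>; they come from one
  neighbourhood \<open>U\<close> of \<open>z\<close> and \<open>w\<close> that lies in all nearby
  domains.\<close>

theorem theorem7p1:
  fixes \<Omega> :: "real \<Rightarrow> complex set" and \<alpha> :: real
  assumes domain: "\<And>t. t \<in> {-1<..<1} \<Longrightarrow> open (\<Omega> t) \<and> connected (\<Omega> t) \<and> \<Omega> t \<noteq> {}"
    and simply_connected: "\<And>t. t \<in> {-1<..<1} \<Longrightarrow> simply_connected (\<Omega> t)"
    and uniformly_bounded: "\<exists>R. \<forall>t\<in>{-1<..<1}. \<Omega> t \<subseteq> ball 0 R"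
    and order_pos: "\<alpha> > 0"
    and hoelder: "hoelder_continuous_family \<Omega> (\<lambda>t z. - boundary_dist (\<Omega> t) z) \<alpha>"
  shows "hoelder_continuous_kernel \<Omega> (\<lambda>t. bergman_kernel (\<Omega> t)) (\<alpha> / 2)"
  unfolding hoelder_continuous_kernel_def
proof (intro ballI)
  fix t\<^sub>0 :: real and z w
  assume t0: "t\<^sub>0 \<in> {-1<..<1}" and z: "z \<in> \<Omega> t\<^sub>0" and w: "w \<in> \<Omega> t\<^sub>0"
  have \<Omega>: "open (\<Omega> t)" "simply_connected (\<Omega> t)" "bounded (\<Omega> t)" if "t \<in> {-1<..<1}" for t
    using domain[OF that] simply_connected[OF that] uniformly_bounded that bounded_subset[OF bounded_ball] by blast+
  \<comment> \<open>The Hoelder hypothesis at \<gamma> = 1.\<close>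
  have "\<exists>b>0. \<exists>c>0. \<forall>t\<in>{-1<..<1}. \<forall>s\<in>{-1<..<1}. \<bar>t - s\<bar> \<le> c \<longrightarrow>
      {z \<in> \<Omega> t. boundary_dist (\<Omega> t) z > b * \<bar>t - s\<bar> powr \<alpha>}
        \<subseteq> {z \<in> \<Omega> s. boundary_dist (\<Omega> s) z > 1 * \<bar>t - s\<bar> powr \<alpha>}"
    using hoelder zero_less_one[where ?'a = real] unfolding hoelder_continuous_family_def minus_minus by blast
  then obtain b c where bc: "0 < b" "0 < c"
    and inner: "\<And>t s. t \<in> {-1<..<1} \<Longrightarrow> s \<in> {-1<..<1} \<Longrightarrow> \<bar>t - s\<bar> \<le> c \<Longrightarrow>
      {z \<in> \<Omega> t. boundary_dist (\<Omega> t) z > b * \<bar>t - s\<bar> powr \<alpha>} \<subseteq> \<Omega> s"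
    by (smt (verit) mem_Collect_eq subset_iff)
  obtain \<phi> \<psi> where \<phi>: "\<phi> holomorphic_on \<Omega> t\<^sub>0" "\<phi> ` \<Omega> t\<^sub>0 = ball 0 1" "\<phi> z = 0"
    and \<psi>: "\<psi> holomorphic_on ball 0 1" "inj_on \<psi> (ball 0 1)" "\<psi> ` ball 0 1 = \<Omega> t\<^sub>0"
    and inv: "\<And>x. x \<in> \<Omega> t\<^sub>0 \<Longrightarrow> \<psi> (\<phi> x) = x"
    using Riemann_map_at[OF \<Omega>[OF t0] z] by metis
  have "cmod (\<phi> w) < 1" using \<phi>(2) w by force
  \<comment> \<open>The disc of radius \<open>R\<close> contains the images 0 and
    \<open>\<phi> w\<close> of both points and has compact closure in the unit disc. Rescaling it to
    the unit disc moves \<open>\<phi> w\<close> to modulus \<open>r\<close>.\<close>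
  then obtain R where R: "cmod (\<phi> w) < R" "R < 1" using dense by blast
  then have R0: "0 < R" using norm_ge_zero[of "\<phi> w"] by linarith
  define r where "r = cmod (\<phi> w) / R"
  have r: "0 \<le> r" "r < 1" using R R0 by (auto simp: r_def)
  define U where "U = \<psi> ` ball 0 R"
  have RB: "ball 0 R \<subseteq> (ball 0 1 :: complex set)" "cball 0 R \<subseteq> (ball 0 1 :: complex set)" using R by auto
  have opU: "open U"
    unfolding U_def by (rule open_mapping_thm3[OF holomorphic_on_subset[OF \<psi>(1) RB(1)] open_ball inj_on_subset[OF \<psi>(2) RB(1)]])
  have zU: "z \<in> U" and wU: "w \<in> U"
    using inv[OF z] inv[OF w] \<phi>(3) R R0 by (force simp: U_def)+
  obtain d1 d2 where "0 < d1" "ball z d1 \<subseteq> U" "0 < d2" "ball w d2 \<subseteq> U"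
    using openE[OF opU zU] openE[OF opU wU] by metis
  then obtain d where d: "0 < d" "ball z d \<subseteq> U" "ball w d \<subseteq> U"
    using subset_ball[of "min d1 d2"] by (metis min.cobounded1 min.cobounded2 min_less_iff_conj subset_trans)
  \<comment> \<open>The boundary distance attains a positive minimum on the compact image of the
    closed disc of radius \<open>R\<close>.\<close>
  obtain e where e: "0 < e" "\<And>x. x \<in> U \<Longrightarrow> e \<le> boundary_dist (\<Omega> t\<^sub>0) x"
  proof -
    let ?C = "\<psi> ` cball 0 R"
    have "compact ?C"
      using holomorphic_on_imp_continuous_on[OF \<psi>(1)] RB(2)
      by (intro compact_continuous_image) (auto intro: continuous_on_subset)
    moreover have "?C \<noteq> {}" using R0 by auto
    moreover have "continuous_on ?C (boundary_dist (\<Omega> t\<^sub>0))"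
      unfolding boundary_dist_def[abs_def] by (intro continuous_on_infdist continuous_on_id)
    ultimately obtain x where x: "x \<in> ?C"
      and min: "\<And>y. y \<in> ?C \<Longrightarrow> boundary_dist (\<Omega> t\<^sub>0) x \<le> boundary_dist (\<Omega> t\<^sub>0) y"
      using continuous_attains_inf[of ?C "boundary_dist (\<Omega> t\<^sub>0)"] by metis
    have "x \<in> \<Omega> t\<^sub>0" using x RB(2) \<psi>(3) by blast
    then have "x \<notin> frontier (\<Omega> t\<^sub>0)"
      using \<Omega>(1)[OF t0] frontier_disjoint_eq[of "\<Omega> t\<^sub>0"] by blast
    moreover have "frontier (\<Omega> t\<^sub>0) \<noteq> {}"
      using frontier_eq_empty[of "\<Omega> t\<^sub>0"] z \<Omega>(3)[OF t0] not_bounded_UNIV by auto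
    ultimately have "0 < boundary_dist (\<Omega> t\<^sub>0) x"
      unfolding boundary_dist_def by (intro infdist_pos_not_in_closed) auto
    moreover have "U \<subseteq> ?C" unfolding U_def by (intro image_mono ball_subset_cball)
    ultimately show thesis using min by (intro that[of "boundary_dist (\<Omega> t\<^sub>0) x"]) auto
  qed
  obtain \<eta>1 where \<eta>1: "0 < \<eta>1" "\<And>x. 0 \<le> x \<Longrightarrow> x < \<eta>1 \<Longrightarrow> x powr \<alpha> < e / b"
    using powr_less_near_0[OF order_pos, of "e / b"] e bc by auto
  define \<kappa> where "\<kappa> = 2 * sqrt (b / d)"
  have \<kappa>: "0 < \<kappa>" using bc d by (simp add: \<kappa>_def)
  obtain \<eta>2 where \<eta>2: "0 < \<eta>2" "\<And>x. 0 \<le> x \<Longrightarrow> x < \<eta>2 \<Longrightarrow> x powr (\<alpha> / 2) < (1 - r) / 2 / \<kappa>"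
    using powr_less_near_0[of "\<alpha> / 2" "(1 - r) / 2 / \<kappa>"] order_pos r \<kappa> by auto
  \<comment> \<open>\<open>\<eta>1\<close> yields \<open>U \<subseteq> \<Omega> t\<close> from the
    distance of \<open>t\<close> to \<open>t\<^sub>0\<close>. The halves of \<open>c\<close> and
    \<open>\<eta>2\<close> account for |t - s| < 2\<eta>; \<open>\<eta>2\<close> ensures
    \<open>\<tau> \<le> (1 - r) / 2\<close>.\<close>
  define \<eta> where "\<eta> = min (c / 2) (min \<eta>1 (\<eta>2 / 2))"
  have \<eta>: "0 < \<eta>" "\<eta> \<le> c / 2" "\<eta> \<le> \<eta>1" "\<eta> \<le> \<eta>2 / 2" using bc \<eta>1 \<eta>2 by (auto simp: \<eta>_def)
  have U\<Omega>: "U \<subseteq> \<Omega> t" if t: "t \<in> {-1<..<1}" "\<bar>t - t\<^sub>0\<bar> < \<eta>" for t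
  proof -
    have t': "\<bar>t\<^sub>0 - t\<bar> \<le> c" "\<bar>t\<^sub>0 - t\<bar> < \<eta>1" using t \<eta> bc by auto
    have "b * \<bar>t\<^sub>0 - t\<bar> powr \<alpha> < e"
      using \<eta>1(2)[OF _ t'(2)] bc by (simp add: field_simps)
    then have "U \<subseteq> {x \<in> \<Omega> t\<^sub>0. boundary_dist (\<Omega> t\<^sub>0) x > b * \<bar>t\<^sub>0 - t\<bar> powr \<alpha>}"
      using e(2) RB(1) \<psi>(3) by (fastforce simp: U_def)
    then show ?thesis using inner[OF t0 t(1) t'(1)] by blast
  qed
  \<comment> \<open>Schwarz' lemma for \<open>f\<close> composed with the rescaled parametrisation
    of \<open>U\<close>, a self-map of the disc fixing 0.\<close>
  have schwarz: "cmod (f w) \<le> r"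
    if t: "t \<in> {-1<..<1}" "\<bar>t - t\<^sub>0\<bar> < \<eta>" and f: "f holomorphic_on \<Omega> t" "f ` \<Omega> t \<subseteq> ball 0 1" "f z = 0" for t f
  proof -
    define h where "h \<zeta> = f (\<psi> (of_real R * \<zeta>))" for \<zeta>
    have RU: "of_real R * \<zeta> \<in> ball 0 R" if "\<zeta> \<in> ball 0 1" for \<zeta> :: complex
      using that R0 by (simp add: norm_mult)
    have f\<psi>: "(f \<circ> \<psi>) holomorphic_on ball 0 R"
      using U\<Omega>[OF t] by (intro holomorphic_on_compose_gen[OF holomorphic_on_subset[OF \<psi>(1) RB(1)] f(1)]) (auto simp: U_def)
    have "(f \<circ> \<psi>) \<circ> (*) (of_real R) holomorphic_on ball 0 1"
    proof (rule holomorphic_on_compose_gen[OF _ f\<psi>])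
      show "(*) (complex_of_real R) ` ball 0 1 \<subseteq> ball 0 R" using RU by blast
    qed (intro holomorphic_intros)
    then have h: "h holomorphic_on ball 0 1" by (simp add: h_def[abs_def] o_def)
    have h1: "cmod (h \<zeta>) < 1" if "cmod \<zeta> < 1" for \<zeta>
    proof -
      have "\<zeta> \<in> ball 0 1" using that by simp
      then have "\<psi> (of_real R * \<zeta>) \<in> U" unfolding U_def by (intro imageI RU)
      then have "h \<zeta> \<in> ball 0 1" unfolding h_def using U\<Omega>[OF t] f(2) by blast
      then show ?thesis by simp
    qed
    have "\<psi> 0 = z" using inv[OF z] \<phi>(3) by simp
    then have h0: "h 0 = 0" using f(3) by (simp add: h_def)
    have "cmod (\<phi> w / of_real R) = r" using R0 by (simp add: r_def norm_divide)
    moreover have "h (\<phi> w / of_real R) = f w" using R0 inv[OF w] by (simp add: h_def)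
    ultimately show ?thesis
      using Schwarz_Lemma(1)[OF h h0 h1, of "\<phi> w / of_real R"] r by simp
  qed
  define C where "C = 16 / (pi * d\<^sup>2 * (((1 + r) / 2)\<^sup>2 - r\<^sup>2) ^ 4)"
  have "r\<^sup>2 < ((1 + r) / 2)\<^sup>2"
    using r by (intro power_strict_mono) auto
  then have C: "0 < C" using d by (simp add: C_def)
  show "\<exists>C>0. \<exists>\<eta>>0. \<forall>t\<in>{-1<..<1}. \<forall>s\<in>{-1<..<1}. \<bar>t - t\<^sub>0\<bar> < \<eta> \<and> \<bar>s - t\<^sub>0\<bar> < \<eta> \<longrightarrow>
      z \<in> \<Omega> t \<inter> \<Omega> s \<and> w \<in> \<Omega> t \<inter> \<Omega> s \<and>
      cmod (bergman_kernel (\<Omega> t) z w - bergman_kernel (\<Omega> s) z w) \<le> C * \<bar>t - s\<bar> powr (\<alpha> / 2)"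
  proof (rule exI[of _ "3 * C * \<kappa>"], rule conjI, (simp add: C \<kappa>; fail), rule exI[of _ \<eta>],
      rule conjI, rule \<eta>(1), intro ballI impI, elim conjE)
    fix t s :: real
    assume ts: "t \<in> {-1<..<1}" "s \<in> {-1<..<1}" and t: "\<bar>t - t\<^sub>0\<bar> < \<eta>" and s: "\<bar>s - t\<^sub>0\<bar> < \<eta>"
    note Ut = U\<Omega>[OF ts(1) t] and Us = U\<Omega>[OF ts(2) s]
    have "cmod (bergman_kernel (\<Omega> t) z w - bergman_kernel (\<Omega> s) z w) \<le> 3 * C * \<kappa> * \<bar>t - s\<bar> powr (\<alpha> / 2)"
    \<comment> \<open>The estimate for two domains takes a positive
      \<open>B = b * \<epsilon>\<close>, hence distinct parameters; for \<open>t = s\<close> both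
      sides are 0.\<close>
    proof (cases "t = s")
      case False
      define \<epsilon> where "\<epsilon> = \<bar>t - s\<bar> powr \<alpha>"
      have \<epsilon>: "0 < \<epsilon>" using False by (simp add: \<epsilon>_def)
      have ts': "\<bar>t - s\<bar> \<le> c" "\<bar>s - t\<bar> \<le> c" "\<bar>t - s\<bar> < \<eta>2" using t s \<eta> by auto
      have "sqrt \<epsilon> = \<bar>t - s\<bar> powr (\<alpha> / 2)"
        by (simp add: \<epsilon>_def powr_half_sqrt[symmetric] powr_powr)
      \<comment> \<open>The square root in \<tau> turns the order \<alpha> of \<open>B\<close> into
        \<alpha>/2.\<close>
      then have \<tau>: "\<kappa> * \<bar>t - s\<bar> powr (\<alpha> / 2) = 2 * sqrt (b * \<epsilon> / d)"
        by (simp add: \<kappa>_def real_sqrt_mult real_sqrt_divide)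
      have \<tau>2: "\<kappa> * \<bar>t - s\<bar> powr (\<alpha> / 2) \<le> (1 - r) / 2"
        using \<eta>2(2)[OF _ ts'(3)] \<kappa> by (simp add: field_simps)
      have sub: "{x \<in> \<Omega> t. boundary_dist (\<Omega> t) x > b * \<epsilon>} \<subseteq> \<Omega> s"
        "{x \<in> \<Omega> s. boundary_dist (\<Omega> s) x > b * \<epsilon>} \<subseteq> \<Omega> t"
        using inner[OF ts ts'(1)] inner[OF ts(2,1) ts'(2)] by (simp_all add: \<epsilon>_def abs_minus_commute)
      have "cmod (bergman_kernel (\<Omega> t) z w - bergman_kernel (\<Omega> s) z w) \<le> 3 * C * (\<kappa> * \<bar>t - s\<bar> powr (\<alpha> / 2))"
      proof (rule bergman_kernel_diff_bound[OF \<Omega>[OF ts(1)] \<Omega>[OF ts(2)] sub d(1) _ _ _ _ _ _ r _ \<tau> \<tau>2 C_def])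
        show "cmod (f w) \<le> r" if "f holomorphic_on \<Omega> t" "f ` \<Omega> t \<subseteq> ball 0 1" "f z = 0" for f
          using schwarz[OF ts(1) t that] .
        show "cmod (f w) \<le> r" if "f holomorphic_on \<Omega> s" "f ` \<Omega> s \<subseteq> ball 0 1" "f z = 0" for f
          using schwarz[OF ts(2) s that] .
      qed (use d Ut Us bc \<epsilon> in auto)
      then show ?thesis by (simp only: mult.assoc)
    qed simp
    then show "z \<in> \<Omega> t \<inter> \<Omega> s \<and> w \<in> \<Omega> t \<inter> \<Omega> s \<and>
        cmod (bergman_kernel (\<Omega> t) z w - bergman_kernel (\<Omega> s) z w) \<le> 3 * C * \<kappa> * \<bar>t - s\<bar> powr (\<alpha> / 2)"
      using zU wU Ut Us by blast
  qed
qed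

end
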